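(* Consider two ergodic unreliable Jackson networks with the same arrival and service intensities, and state processes $\mathbf Z$ and $\mathbf Z'$ (with stationary distribution $\tilde\pi$). Assume that the routing matrices $R$ and $R'$ are reversible with respect to $\xi$. Both networks follow a rerouting mechanism, $(R^D)_{D\subseteq\tilde J}$ and $(R'^D)_{D\subseteq\tilde J}$ respectively, satisfying the rerouting assumption, such that $R^D$ and $R'^D$ are reversible with respect to $\xi^D$. If $R^D$ and $R'^D$ are ordered for all $D$ in the positive semidefinite order, $R'^D\prec_{pd}R^D$, then for any function $f\in L^2_0(\tilde{\mathbb E},\tilde\pi):=\{g\in L^2(\tilde{\mathbb E},\tilde\pi):\tilde\pi(g)=0\}$ $$v(f,\mathrm{Id}+\varepsilon Q^{\mathbf Z})\ge v(f,\mathrm{Id}+\varepsilon Q^{\mathbf Z'}).$$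
   Context: Notation: $\mathbb N=\{0,1,2,\dots\}$, $\tilde J=\{1,\dots,J\}$, $\tilde J_0=\{0,1,\dots,J\}$; $\subset$ denotes strict inclusion; $e_j$ is the $j$-th standard base vector of $\mathbb N^J$. $\langle f,g\rangle_{\nu}=\int fg\,d\nu$, $\tilde\pi(f)=\int f\,d\tilde\pi$, and $L^2(\tilde{\mathbb E},\tilde\pi)$ is the space of real functions on $\tilde{\mathbb E}$ that are square integrable with respect to $\tilde\pi$. Network data: an arrival intensity $\lambda>0$; an irreducible stochastic routing matrix $R=[r_{ij}]_{i,j\in\tilde J_0}$ ($r_{00}\ge 0$ allowed; node $0$ is source and sink); service rates $\mu_j(k)>0$ for $k\ge1$, $\mu_j(0)=0$, with $\sup_{j,k}\mu_j(k)<\infty$. The traffic equations $\eta_j=\lambda r_{0j}+\sum_{i=1}^J\eta_ir_{ij}$, $j\in\tilde J$, have a unique solution $(\eta_j)_{j\in\tilde J}$; put $\eta_0=\lambda$. The network without breakdowns is assumed ergodic, i.e. $C_j:=\sum_{m\ge0}\prod_{k=1}^{m}\eta_j/\mu_j(k)<\infty$ for all $j$, and $\pi(n)=\prod_{j=1}^J C_j^{-1}\prod_{k=1}^{n_j}\frac{\eta_j}{\mu_j(k)}$ on $\mathbb N^J$ is its stationary distribution. Breakdown and repair: functions $A,B:2^{\tilde J}\to[0,\infty)$ with $A(\emptyset)=B(\emptyset)=1$, $A(I)/A(D)<\infty$ for all $D\subset I\subseteq\tilde J$ and $B(D)/B(H)<\infty$ for all $H\subset D\subseteq\tilde J$ (conventions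 $0/0=0$, $1/0=\infty$). $\mathbf Y$ is the Markov process on $2^{\tilde J}$ (its state is the set of broken down nodes) with rates $q^{\mathbf Y}(D,I)=A(I)/A(D)$ for $D\subset I$, $q^{\mathbf Y}(D,H)=B(D)/B(H)$ for $H\subset D$, other off-diagonal rates zero, and generator $(Q^{\mathbf Y}h)(D)=\sum_{H\subset D}q^{\mathbf Y}(D,H)(h(H)-h(D))+\sum_{I\supset D}q^{\mathbf Y}(D,I)(h(I)-h(D))$. It is reversible with respect to the probability $\hat\pi(D)=\hat C^{-1}A(D)/B(D)$. Rerouting assumption: for each $D\subseteq\tilde J$ there is a routing (stochastic) matrix $R^D=[r^D_{ij}]_{i,j\in\tilde J_0\setminus D}$, $R^\emptyset=R$, used when the nodes in $D$ are down, such that $\eta_j=\lambda r^D_{0j}+\sum_{i\in\tilde J\setminus D}\eta_ir^D_{ij}$ for all $j\in\tilde J\setminus D$ (same $\eta$ for every $D$). Then $(\eta_j)_{j\in\tilde J_0\setminus D}$ solves $x=x\cdot R^D$; its normalization is the probability vector $\xi^D_j=\eta_j/\sum_{k\in\tilde J_0\setminus D}\eta_k$, and $\xi=\xi^\emptyset$. A matrix $P=[p_{ij}]$ is reversible with respect to $\nu$ if $\nu_ip_{ij}=\nu_jp_{ji}$ for all $i,j$. Unreliable Jackson network process $\mathbf Z=(\mathbf Y,\mathbf X)$: the Markov process on $\tilde{\mathbb E}=2^{\tilde J}\times\mathbb N^J$ with generator $(Q^{\mathbf Z}f)(D,n)=\sum_{j\in\tilde J\setminus D}\lambda r^D_{0j}(f(D,n+e_j)-f(D,n))+\sum_{j\in\tilde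 J\setminus D}\mu_j(n_j)r^D_{j0}(f(D,n-e_j)-f(D,n))+\sum_{j\in\tilde J\setminus D}\mu_j(n_j)\sum_{i\in\tilde J\setminus D}r^D_{ji}(f(D,n-e_j+e_i)-f(D,n))+(Q^{\mathbf Y}f(\cdot,n))(D)$. Terms with factor $\mu_j(0)$ are zero. If $\mathbf Z$ is ergodic, its unique stationary distribution is $\tilde\pi(D,n)=\hat\pi(D)\pi(n)$. $\mathbf Z'=(\mathbf Y',\mathbf X')$ is an unreliable Jackson network process of the same type on the same node set, with the same $\lambda$ and $\mu_j$, with routing matrix $R'$ and rerouting matrices $(R'^D)$ ($R'^\emptyset=R'$), and with a breakdown-repair process $\mathbf Y'$ given in the same way by functions $A',B'$. The two networks compared have the same stationary distribution $\tilde\pi$. $\varepsilon>0$ is sufficiently small that $\mathrm{Id}+\varepsilon Q^{\mathbf Z}$ and $\mathrm{Id}+\varepsilon Q^{\mathbf Z'}$ are stochastic matrices. Asymptotic variance: for a transition kernel $K$ with stationary distribution $\tilde\pi$, $v(f,K)=\langle f,f\rangle_{\tilde\pi}-\tilde\pi(f)+2\sum_{k=1}^\infty\langle f,K^kf\rangle_{\tilde\pi}$. Positive semidefinite order: for transition matrices $P,P'$ on a finite set with common invariant probability vector $\nu$, $P'\prec_{pd}P$ means that $P-P'$ is positive semidefinite, i.e. $\langle h,(P-P')h\rangle_\nu\ge0$ for all real $h$; for $R^D,R'^D$ take $\nu=\xi^D$.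
   Formalization: Adds the hypothesis that Q^Y − Q^{Y'} is positive semidefinite in L²(π̂) (true if Y' and Y have equal rates): with A', B' free the claim fails, e.g. J=1, R'=R, A', B' halved at {1}; the claim for all f implies it. A(D)/B(D)<∞ is also made explicit so that π̂ is a probability. *)

theory Defs
  imports "HOL-Analysis.Analysis"
begin

section \<open>Unreliable Jackson networks\<close>

text \<open>
  The node set \<open>{1..J}\<close> is the finite type \<open>'j\<close> (so \<open>J \<ge> 1\<close> is arbitrary), and \<open>{0..J}\<close> is
  \<open>'j option\<close>, with \<open>None\<close> the source/sink \<open>0\<close>. The routing matrix is \<open>rerouting N {}\<close>. Only the
  entries of \<open>rerouting N D\<close> with both indices in \<open>up_nodes D\<close> are ever used. The field
  \<open>throughput\<close> is the solution \<open>\<eta>\<close> of the traffic equations, \<open>breakdown\<close> and \<open>repair\<close> are the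
  functions \<open>A\<close> and \<open>B\<close>.
\<close>

record 'j network =
  arrival :: real
  service :: "'j \<Rightarrow> nat \<Rightarrow> real"
  rerouting :: "'j set \<Rightarrow> 'j option \<Rightarrow> 'j option \<Rightarrow> real"
  throughput :: "'j \<Rightarrow> real"
  breakdown :: "'j set \<Rightarrow> real"
  repair :: "'j set \<Rightarrow> real"

type_synonym 'j state = "'j set \<times> ('j \<Rightarrow> nat)"

abbreviation routing :: "'j network \<Rightarrow> 'j option \<Rightarrow> 'j option \<Rightarrow> real" where
  "routing N \<equiv> rerouting N {}"

definition up_nodes :: "'j set \<Rightarrow> 'j option set" where
  "up_nodes D = - (Some ` D)"

definition throughput0 :: "'j network \<Rightarrow> 'j option \<Rightarrow> real" where
  "throughput0 N i = (case i of None \<Rightarrow> arrival N | Some j \<Rightarrow> throughput N j)"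

definition xi :: "('j::finite) network \<Rightarrow> 'j set \<Rightarrow> 'j option \<Rightarrow> real" where
  "xi N D j = throughput0 N j / (\<Sum>k\<in>up_nodes D. throughput0 N k)"

definition stochastic_matrix :: "'i set \<Rightarrow> ('i \<Rightarrow> 'i \<Rightarrow> real) \<Rightarrow> bool" where
  "stochastic_matrix S P \<longleftrightarrow> (\<forall>i\<in>S. (\<forall>j\<in>S. 0 \<le> P i j) \<and> (\<Sum>j\<in>S. P i j) = 1)"

definition irreducible_matrix :: "('i \<Rightarrow> 'i \<Rightarrow> real) \<Rightarrow> bool" where
  "irreducible_matrix P \<longleftrightarrow> (\<forall>i j. (i, j) \<in> {(k, l). 0 < P k l}\<^sup>+)"

definition reversible_matrix :: "'i set \<Rightarrow> ('i \<Rightarrow> real) \<Rightarrow> ('i \<Rightarrow> 'i \<Rightarrow> real) \<Rightarrow> bool" where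
  "reversible_matrix S \<nu> P \<longleftrightarrow> (\<forall>i\<in>S. \<forall>j\<in>S. \<nu> i * P i j = \<nu> j * P j i)"

text \<open>
  Division on \<^typ>\<open>ennreal\<close> follows the conventions \<open>0/0 = 0\<close> and \<open>1/0 = \<infinity>\<close>; on quotients that
  are finite in this sense it agrees with division on \<^typ>\<open>real\<close>, which is used for the rates and
  the stationary distribution below. The last conjunct says that the weights \<open>A(D)/B(D)\<close> of
  \<open>\<pi>\<close>-hat are finite, as they must be for it to be a probability.
\<close>

definition breakdown_repair_functions :: "('j set \<Rightarrow> real) \<Rightarrow> ('j set \<Rightarrow> real) \<Rightarrow> bool" where
  "breakdown_repair_functions A B \<longleftrightarrow>
     (\<forall>D. 0 \<le> A D \<and> 0 \<le> B D) \<and> A {} = 1 \<and> B {} = 1 \<and>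
     (\<forall>D I. D \<subset> I \<longrightarrow> ennreal (A I) / ennreal (A D) < \<infinity>) \<and>
     (\<forall>H D. H \<subset> D \<longrightarrow> ennreal (B D) / ennreal (B H) < \<infinity>) \<and>
     (\<forall>D. ennreal (A D) / ennreal (B D) < \<infinity>)"

text \<open>The rerouting assumption for \<open>D = {}\<close> is the system of traffic equations.\<close>

definition unreliable_jackson_network :: "('j::finite) network \<Rightarrow> bool" where
  "unreliable_jackson_network N \<longleftrightarrow>
     0 < arrival N \<and>
     irreducible_matrix (routing N) \<and>
     (\<forall>j. service N j 0 = 0 \<and> (\<forall>k\<ge>1. 0 < service N j k)) \<and>
     bdd_above (range (\<lambda>(j, k). service N j k)) \<and>
     (\<forall>D. stochastic_matrix (up_nodes D) (rerouting N D)) \<and>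
     (\<forall>D. \<forall>j\<in>-D. throughput N j =
        arrival N * rerouting N D None (Some j) +
        (\<Sum>i\<in>-D. throughput N i * rerouting N D (Some i) (Some j))) \<and>
     (\<forall>j. summable (\<lambda>m. \<Prod>k=1..m. throughput N j / service N j k)) \<and>
     breakdown_repair_functions (breakdown N) (repair N)"


section \<open>Generators and stationary distributions\<close>

definition qY :: "'j network \<Rightarrow> 'j set \<Rightarrow> 'j set \<Rightarrow> real" where
  "qY N D I =
     (if D \<subset> I then breakdown N I / breakdown N D
      else if I \<subset> D then repair N D / repair N I
      else 0)"

definition genY :: "'j network \<Rightarrow> ('j set \<Rightarrow> real) \<Rightarrow> 'j set \<Rightarrow> real" where
  "genY N h D =
     (\<Sum>H | H \<subset> D. qY N D H * (h H - h D)) +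
     (\<Sum>I | D \<subset> I. qY N D I * (h I - h D))"

definition plus_unit :: "('j \<Rightarrow> nat) \<Rightarrow> 'j \<Rightarrow> 'j \<Rightarrow> nat" where
  "plus_unit n j = n(j := n j + 1)"

text \<open>Truncated at \<open>n j = 0\<close>, where it only occurs with the factor \<open>service N j 0 = 0\<close>.\<close>

definition minus_unit :: "('j \<Rightarrow> nat) \<Rightarrow> 'j \<Rightarrow> 'j \<Rightarrow> nat" where
  "minus_unit n j = n(j := n j - 1)"

definition genZ :: "('j::finite) network \<Rightarrow> ('j state \<Rightarrow> real) \<Rightarrow> 'j state \<Rightarrow> real" where
  "genZ N f = (\<lambda>(D, n).
     (\<Sum>j\<in>-D. arrival N * rerouting N D None (Some j) * (f (D, plus_unit n j) - f (D, n))) +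
     (\<Sum>j\<in>-D. service N j (n j) * rerouting N D (Some j) None *
        (f (D, minus_unit n j) - f (D, n))) +
     (\<Sum>j\<in>-D. service N j (n j) *
        (\<Sum>i\<in>-D. rerouting N D (Some j) (Some i) *
           (f (D, plus_unit (minus_unit n j) i) - f (D, n)))) +
     genY N (\<lambda>D'. f (D', n)) D)"

definition pi_network :: "('j::finite) network \<Rightarrow> ('j \<Rightarrow> nat) \<Rightarrow> real" where
  "pi_network N n =
     (\<Prod>j\<in>UNIV. inverse (\<Sum>m. \<Prod>k=1..m. throughput N j / service N j k) *
        (\<Prod>k=1..n j. throughput N j / service N j k))"

definition pi_hat :: "('j::finite) network \<Rightarrow> 'j set \<Rightarrow> real" where
  "pi_hat N D = inverse (\<Sum>H\<in>UNIV. breakdown N H / repair N H) * (breakdown N D / repair N D)"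

definition pi_tilde :: "('j::finite) network \<Rightarrow> 'j state \<Rightarrow> real" where
  "pi_tilde N = (\<lambda>(D, n). pi_hat N D * pi_network N n)"


section \<open>Markov operators on a countable state space\<close>

text \<open>
  Generators and transition kernels are given by their action on functions. The entry at
  \<open>(x, y)\<close> of the matrix of an operator \<open>T\<close> is \<open>T (indicator {y}) x\<close>.
\<close>

definition stochastic_operator :: "(('s \<Rightarrow> real) \<Rightarrow> 's \<Rightarrow> real) \<Rightarrow> bool" where
  "stochastic_operator T \<longleftrightarrow>
     (\<forall>x. (\<forall>y. 0 \<le> T (indicator {y}) x) \<and> ((\<lambda>y. T (indicator {y}) x) has_sum 1) UNIV)"

definition id_plus :: "real \<Rightarrow> (('s \<Rightarrow> real) \<Rightarrow> 's \<Rightarrow> real) \<Rightarrow> ('s \<Rightarrow> real) \<Rightarrow> 's \<Rightarrow> real" where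
  "id_plus \<epsilon> Q f x = f x + \<epsilon> * Q f x"

text \<open>
  The transition function \<open>exp (t Q)\<close>; the series converges because the generators considered
  here have uniformly bounded rates.
\<close>

definition transition_prob :: "(('s \<Rightarrow> real) \<Rightarrow> 's \<Rightarrow> real) \<Rightarrow> real \<Rightarrow> 's \<Rightarrow> 's \<Rightarrow> real" where
  "transition_prob Q t x y = (\<Sum>k. t ^ k / fact k * (Q ^^ k) (indicator {y}) x)"

text \<open>
  Ergodicity is convergence to a limiting probability distribution from every initial state.
  Irreducibility on the whole state space is not demanded, since sets \<open>D\<close> with \<open>A(D) = 0\<close> cannot
  be reached.
\<close>

definition ergodic :: "(('s \<Rightarrow> real) \<Rightarrow> 's \<Rightarrow> real) \<Rightarrow> bool" where
  "ergodic Q \<longleftrightarrow>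
     (\<exists>p. (\<forall>y. 0 \<le> p y) \<and> (p has_sum 1) UNIV \<and>
        (\<forall>x y. ((\<lambda>t. transition_prob Q t x y) \<longlongrightarrow> p y) at_top))"

definition inner_wrt :: "'s set \<Rightarrow> ('s \<Rightarrow> real) \<Rightarrow> ('s \<Rightarrow> real) \<Rightarrow> ('s \<Rightarrow> real) \<Rightarrow> real" where
  "inner_wrt S \<nu> f g = (\<Sum>\<^sub>\<infinity>x\<in>S. f x * g x * \<nu> x)"

definition mean_wrt :: "('s \<Rightarrow> real) \<Rightarrow> ('s \<Rightarrow> real) \<Rightarrow> real" where
  "mean_wrt \<nu> f = (\<Sum>\<^sub>\<infinity>x. f x * \<nu> x)"

definition L2 :: "('s \<Rightarrow> real) \<Rightarrow> ('s \<Rightarrow> real) set" where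
  "L2 \<nu> = {f. (\<lambda>x. (f x)\<^sup>2 * \<nu> x) summable_on UNIV}"

definition L2_0 :: "('s \<Rightarrow> real) \<Rightarrow> ('s \<Rightarrow> real) set" where
  "L2_0 \<nu> = {f \<in> L2 \<nu>. mean_wrt \<nu> f = 0}"

text \<open>
  Extended-real valued, because without a spectral gap the series of autocovariances can diverge
  to \<open>\<infinity>\<close>.
\<close>

definition asymptotic_variance ::
  "('s \<Rightarrow> real) \<Rightarrow> ('s \<Rightarrow> real) \<Rightarrow> (('s \<Rightarrow> real) \<Rightarrow> 's \<Rightarrow> real) \<Rightarrow> ereal" where
  "asymptotic_variance \<nu> f K =
     ereal (inner_wrt UNIV \<nu> f f - mean_wrt \<nu> f) +
     2 * (\<Sum>k. ereal (inner_wrt UNIV \<nu> f ((K ^^ Suc k) f)))"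


section \<open>Positive semidefinite order\<close>

text \<open>\<open>pd_le S \<nu> P' P\<close> is \<open>P' \<prec>\<^sub>p\<^sub>d P\<close> for matrices indexed by the finite set \<open>S\<close>.\<close>

definition pd_le :: "'i set \<Rightarrow> ('i \<Rightarrow> real) \<Rightarrow> ('i \<Rightarrow> 'i \<Rightarrow> real) \<Rightarrow> ('i \<Rightarrow> 'i \<Rightarrow> real) \<Rightarrow> bool" where
  "pd_le S \<nu> P' P \<longleftrightarrow> (\<forall>h. 0 \<le> inner_wrt S \<nu> h (\<lambda>i. \<Sum>j\<in>S. (P i j - P' i j) * h j))"

text \<open>
  The same order for the generators of the breakdown-repair processes (\<open>Q\<^sup>Y - Q\<^sup>Y\<^sup>'\<close> is positive
  semidefinite). It holds trivially if both networks have the same breakdown and repair rates.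
  Some such condition is needed to compare asymptotic variances: a common stationary distribution
  only fixes the ratio \<open>A/B\<close>, and a slower environment increases the asymptotic variance of
  functions of \<open>D\<close> alone. Comparing all such functions forces exactly this order.
\<close>

definition breakdown_pd_le :: "('j::finite) network \<Rightarrow> 'j network \<Rightarrow> bool" where
  "breakdown_pd_le N' N \<longleftrightarrow>
     (\<forall>h. 0 \<le> inner_wrt UNIV (pi_hat N) h (\<lambda>D. genY N h D - genY N' h D))"

end

theory Submission
  imports Defs
begin

text \<open>
  Both kernels \<open>K = Id + \<epsilon> Q\<^sup>Z\<close> and \<open>K' = Id + \<epsilon> Q\<^sup>Z\<^sup>'\<close> are self-adjoint contractions of
  \<open>L\<^sup>2(\<pi>)\<close>, \<open>\<pi>\<close> the common stationary distribution, and the theorem says that the sum of the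
  autocovariances \<open>\<langle>f, K\<^sup>k f\<rangle>\<close> decreases when the quadratic form of the kernel decreases. Formally
  this sum is
  \<open>\<langle>f, (I - K)\<^sup>-\<^sup>1 f\<rangle> = sup\<^sub>h (2 \<langle>h, f\<rangle> - \<langle>h, (I - K) h\<rangle>)\<close>,
  and the right-hand side is monotone in \<open>K\<close>.

  Without a spectral gap the inverse need not exist and the sum may be infinite. So the supremum is
  approached through the partial sums \<open>h\<^sub>n\<close> of the Neumann series. With \<open>S\<^sub>n\<close> the sum of the first \<open>n\<close>
  autocovariances, \<open>(I - K) h\<^sub>n = f - K\<^sup>n f\<close> gives \<open>\<langle>h\<^sub>n, (I - K) h\<^sub>n\<rangle> = 2 S\<^sub>n - S\<^sub>2\<^sub>n\<close>. Positivity
  of the form at \<open>h - h\<^sub>n\<close> yields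
  \<open>2 \<langle>h, f\<rangle> - \<langle>h, (I - K) h\<rangle> \<le> 2 \<langle>h, K\<^sup>n f\<rangle> + 2 S\<^sub>n - S\<^sub>2\<^sub>n\<close> (\<open>potential_variational_bound\<close>). If the
  sum \<open>S\<close> for \<open>K\<close> is finite, the right-hand side tends to \<open>S\<close>, and choosing for \<open>h\<close> the Neumann partial
  sum \<open>h'\<^sub>m\<close> of the other kernel gives \<open>S'\<^sub>2\<^sub>m \<le> S\<close> for all \<open>m\<close> (\<open>asymptotic_variance_antimono\<close>).

  The sums must also exist. \<open>S\<^sub>2\<^sub>n\<close> increases since \<open>I + K\<close> is positive semidefinite, but the odd
  partial sums could oscillate if \<open>-1\<close> were an eigenvalue of \<open>K\<close>. The form of \<open>I + K\<close> is a sum of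
  squares \<open>(g x + g y)\<^sup>2\<close> over the edges of the transition graph, and one state with a positive holding
  probability together with connectedness of the support of \<open>\<pi>\<close> excludes this
  (\<open>autocov_sum_limit\<close>). For the network such a state is the one without jobs and without
  broken nodes, because its exit rate is smaller than that of a state with one job
  (\<open>exit_rate_less\<close>).

  The comparison of the quadratic forms of the generators rests on one substitution. Writing
  \<open>n = m + e\<^sub>i\<close> for a state from which a job at \<open>i\<close> is moved and using
  \<open>\<pi>(m + e\<^sub>i) \<mu>\<^sub>i(m\<^sub>i + 1) = \<pi>(m) \<eta>\<^sub>i\<close>, the form of the generator becomes an average over \<open>m\<close> of the
  forms of the finite matrices \<open>R\<^sup>D - Id\<close> with respect to \<open>\<eta>\<close>, plus the form of the
  breakdown-repair generator (\<open>inner_genZ\<close>). The hypotheses order these termwise. It suffices to know this for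
  finitely supported functions (\<open>kernel_order_from_finite_support\<close>), so all sums over states in this
  part are finite.
\<close>

section \<open>Square-summable functions\<close>

lemma weighted_product_summable:
  fixes u v w :: "'a \<Rightarrow> real"
  assumes "\<And>x. x \<in> X \<Longrightarrow> 0 \<le> w x"
    and "(\<lambda>x. (u x)\<^sup>2 * w x) summable_on X" "(\<lambda>x. (v x)\<^sup>2 * w x) summable_on X"
  shows "(\<lambda>x. u x * v x * w x) summable_on X"
proof (rule abs_summable_summable[OF Infinite_Sum.abs_summable_on_comparison_test'])
  show "(\<lambda>x. (u x)\<^sup>2 * w x + (v x)\<^sup>2 * w x) summable_on X"
    by (intro summable_on_add assms)
  fix x assume "x \<in> X"
  have "\<bar>u x * v x\<bar> \<le> (u x)\<^sup>2 + (v x)\<^sup>2"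
    using sum_squares_bound[of "\<bar>u x\<bar>" "\<bar>v x\<bar>"] abs_ge_zero[of "u x * v x"]
    unfolding power2_abs abs_mult by linarith
  then show "norm (u x * v x * w x) \<le> (u x)\<^sup>2 * w x + (v x)\<^sup>2 * w x"
    using assms(1)[OF \<open>x \<in> X\<close>]
    by (simp add: abs_mult mult_right_mono flip: distrib_right)
qed

lemma L2_product_summable:
  assumes "\<And>x. 0 \<le> \<nu> x" "f \<in> L2 \<nu>" "g \<in> L2 \<nu>"
  shows "(\<lambda>x. f x * g x * \<nu> x) summable_on UNIV"
  using assms by (intro weighted_product_summable) (auto simp: L2_def)

lemma L2_add:
  assumes "\<And>x. 0 \<le> \<nu> x" "f \<in> L2 \<nu>" "g \<in> L2 \<nu>"
  shows "(\<lambda>x. f x + g x) \<in> L2 \<nu>"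
proof -
  have "(\<lambda>x. (f x)\<^sup>2 * \<nu> x + (g x)\<^sup>2 * \<nu> x + 2 * (f x * g x * \<nu> x)) summable_on UNIV"
    using assms L2_product_summable[OF assms]
    by (intro summable_on_add summable_on_cmult_right) (auto simp: L2_def)
  then show ?thesis
    by (simp add: L2_def power2_sum algebra_simps)
qed

lemma L2_cmult: "f \<in> L2 \<nu> \<Longrightarrow> (\<lambda>x. c * f x) \<in> L2 \<nu>"
  unfolding L2_def
  by (auto simp: power_mult_distrib mult.assoc intro: summable_on_cmult_right)

lemma L2_diff:
  assumes "\<And>x. 0 \<le> \<nu> x" "f \<in> L2 \<nu>" "g \<in> L2 \<nu>"
  shows "(\<lambda>x. f x - g x) \<in> L2 \<nu>"
  using L2_add[OF assms(1,2) L2_cmult[OF assms(3), of "-1"]] by simp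

lemma L2_sum:
  assumes "\<And>x. 0 \<le> \<nu> x" "finite I" "\<And>i. i \<in> I \<Longrightarrow> F i \<in> L2 \<nu>"
  shows "(\<lambda>x. \<Sum>i\<in>I. F i x) \<in> L2 \<nu>"
  using assms(2,3)
proof (induction I rule: finite_induct)
  case empty
  then show ?case by (simp add: L2_def)
next
  case (insert i I)
  then show ?case by (simp add: L2_add[OF assms(1)])
qed

lemma inner_wrt_commute: "inner_wrt X \<nu> f g = inner_wrt X \<nu> g f"
  by (simp add: inner_wrt_def mult.commute)

lemma inner_wrt_self_nonneg:
  assumes "\<And>x. 0 \<le> \<nu> x"
  shows "0 \<le> inner_wrt UNIV \<nu> f f"
  unfolding inner_wrt_def using assms by (intro infsum_nonneg) simp

lemma inner_wrt_add_right:
  assumes "\<And>x. 0 \<le> \<nu> x" "f \<in> L2 \<nu>" "g \<in> L2 \<nu>" "h \<in> L2 \<nu>"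
  shows "inner_wrt UNIV \<nu> h (\<lambda>x. f x + g x) = inner_wrt UNIV \<nu> h f + inner_wrt UNIV \<nu> h g"
  using infsum_add[OF L2_product_summable[OF assms(1,4,2)] L2_product_summable[OF assms(1,4,3)]]
  by (simp add: inner_wrt_def algebra_simps)

lemma inner_wrt_cmult_right:
  "inner_wrt X \<nu> h (\<lambda>x. c * f x) = c * inner_wrt X \<nu> h f"
  by (simp add: inner_wrt_def mult.left_commute[of _ c] mult.assoc infsum_cmult_right')

lemma inner_wrt_diff_right:
  assumes "\<And>x. 0 \<le> \<nu> x" "f \<in> L2 \<nu>" "g \<in> L2 \<nu>" "h \<in> L2 \<nu>"
  shows "inner_wrt UNIV \<nu> h (\<lambda>x. f x - g x) = inner_wrt UNIV \<nu> h f - inner_wrt UNIV \<nu> h g"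
  using inner_wrt_add_right[OF assms(1,2) L2_cmult[OF assms(3), of "-1"] assms(4)]
    inner_wrt_cmult_right[of UNIV \<nu> h "-1" g] by simp

lemma inner_wrt_sum_right:
  assumes "\<And>x. 0 \<le> \<nu> x" "finite I" "h \<in> L2 \<nu>" "\<And>i. i \<in> I \<Longrightarrow> F i \<in> L2 \<nu>"
  shows "inner_wrt UNIV \<nu> h (\<lambda>x. \<Sum>i\<in>I. F i x) = (\<Sum>i\<in>I. inner_wrt UNIV \<nu> h (F i))"
  using assms(2,4)
proof (induction I rule: finite_induct)
  case empty
  then show ?case by (simp add: inner_wrt_def)
next
  case (insert i I)
  then show ?case
    by (simp add: inner_wrt_add_right[OF assms(1) _ L2_sum[OF assms(1)] assms(3)])
qed

text \<open>
  Outside a large finite set \<open>h\<close> is small in the norm, so there only the boundedness of the norms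
  of \<open>g n\<close> is needed; on the finite set pointwise convergence is enough.
\<close>

lemma bounded_pointwise_imp_weak_convergence:
  fixes g :: "nat \<Rightarrow> 'a \<Rightarrow> real"
  assumes \<nu>: "\<And>x. 0 \<le> \<nu> x" and h: "h \<in> L2 \<nu>" and g: "\<And>n. g n \<in> L2 \<nu>"
    and bound: "\<And>n. inner_wrt UNIV \<nu> (g n) (g n) \<le> M"
    and pointwise: "\<And>x. 0 < \<nu> x \<Longrightarrow> (\<lambda>n. g n x) \<longlonglongrightarrow> 0"
  shows "(\<lambda>n. inner_wrt UNIV \<nu> h (g n)) \<longlonglongrightarrow> 0"
proof (rule LIMSEQ_I)
  fix e :: real assume "0 < e"
  have M: "0 \<le> M" using inner_wrt_self_nonneg[OF \<nu>] bound by (rule order_trans)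
  \<comment> \<open>In \<open>2 * \<bar>h * g\<bar> \<le> h\<^sup>2 / t + t * g\<^sup>2\<close> this \<open>t\<close> makes the second term small; the finite
    set \<open>F\<close> is chosen afterwards to make the first one small.\<close>
  define t where "t = e / (2 * (M + 1))"
  have "0 < t" using \<open>0 < e\<close> M by (simp add: t_def)
  have tM: "t * M < e / 2" using \<open>0 < e\<close> M by (simp add: t_def field_simps)
  have h2: "(\<lambda>x. (h x)\<^sup>2 * \<nu> x) summable_on UNIV" using h by (simp add: L2_def)
  obtain F where F: "finite F" "dist (\<Sum>x\<in>F. (h x)\<^sup>2 * \<nu> x) (\<Sum>\<^sub>\<infinity>x. (h x)\<^sup>2 * \<nu> x) \<le> t * e / 8"
    using infsum_finite_approximation[OF h2, of "t * e / 8"] \<open>0 < e\<close> \<open>0 < t\<close> by auto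
  have tail: "(\<Sum>\<^sub>\<infinity>x\<in>-F. (h x)\<^sup>2 * \<nu> x) \<le> t * e / 8"
  proof -
    have "(\<Sum>\<^sub>\<infinity>x. (h x)\<^sup>2 * \<nu> x) = (\<Sum>x\<in>F. (h x)\<^sup>2 * \<nu> x) + (\<Sum>\<^sub>\<infinity>x\<in>-F. (h x)\<^sup>2 * \<nu> x)"
      using infsum_Un_disjoint[of "\<lambda>x. (h x)\<^sup>2 * \<nu> x" F "-F"] F(1)
        summable_on_subset[OF h2, of "-F"] by (simp add: Compl_partition)
    then show ?thesis using F(2) by (simp add: dist_real_def)
  qed
  have "(\<lambda>n. \<Sum>x\<in>F. h x * g n x * \<nu> x) \<longlonglongrightarrow> 0"
  proof (rule tendsto_null_sum)
    fix x assume "x \<in> F"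
    show "(\<lambda>n. h x * g n x * \<nu> x) \<longlonglongrightarrow> 0"
    proof (cases "\<nu> x = 0")
      case False
      then have "(\<lambda>n. g n x) \<longlonglongrightarrow> 0" using pointwise \<nu>[of x] by force
      then show ?thesis using tendsto_mult_left_zero tendsto_mult_right_zero by blast
    qed simp
  qed
  then obtain n0 where n0: "\<And>n. n \<ge> n0 \<Longrightarrow> \<bar>\<Sum>x\<in>F. h x * g n x * \<nu> x\<bar> < e / 8"
    using LIMSEQ_D[of "\<lambda>n. \<Sum>x\<in>F. h x * g n x * \<nu> x" 0 "e / 8"] \<open>0 < e\<close> by auto
  have "\<bar>inner_wrt UNIV \<nu> h (g n)\<bar> < e" if "n \<ge> n0" for n
  proof -
    have hg: "(\<lambda>x. h x * g n x * \<nu> x) summable_on UNIV"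
      by (rule L2_product_summable[OF \<nu> h g])
    have g2: "(\<lambda>x. (g n x)\<^sup>2 * \<nu> x) summable_on UNIV" using g by (simp add: L2_def)
    note s = summable_on_subset[OF hg, of "-F"] summable_on_subset[OF h2, of "-F"]
      summable_on_subset[OF g2, of "-F"]
    have split: "inner_wrt UNIV \<nu> h (g n) =
        (\<Sum>x\<in>F. h x * g n x * \<nu> x) + (\<Sum>\<^sub>\<infinity>x\<in>-F. h x * g n x * \<nu> x)"
      using infsum_Un_disjoint[of "\<lambda>x. h x * g n x * \<nu> x" F "-F"] F(1) s(1)
      by (simp add: Compl_partition inner_wrt_def)
    let ?b = "\<lambda>x. inverse t * ((h x)\<^sup>2 * \<nu> x) + t * ((g n x)\<^sup>2 * \<nu> x)"
    have b: "?b summable_on -F"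
      by (intro summable_on_add summable_on_cmult_right s) simp_all
    have infb: "infsum ?b (-F) \<le> e / 8 + t * M"
    proof -
      have "infsum ?b (-F) = inverse t * (\<Sum>\<^sub>\<infinity>x\<in>-F. (h x)\<^sup>2 * \<nu> x) + t * (\<Sum>\<^sub>\<infinity>x\<in>-F. (g n x)\<^sup>2 * \<nu> x)"
        by (subst infsum_add) (auto intro!: summable_on_cmult_right s simp: infsum_cmult_right')
      moreover have "inverse t * (\<Sum>\<^sub>\<infinity>x\<in>-F. (h x)\<^sup>2 * \<nu> x) \<le> inverse t * (t * e / 8)"
        by (rule mult_left_mono[OF tail]) (use \<open>0 < t\<close> in simp)
      moreover have "inverse t * (t * e / 8) = e / 8" using \<open>0 < t\<close> by simp
      moreover have "(\<Sum>\<^sub>\<infinity>x\<in>-F. (g n x)\<^sup>2 * \<nu> x) \<le> inner_wrt UNIV \<nu> (g n) (g n)"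
        unfolding inner_wrt_def power2_eq_square[symmetric]
        by (intro infsum_mono2 s g2) (auto simp: \<nu>)
      then have "t * (\<Sum>\<^sub>\<infinity>x\<in>-F. (g n x)\<^sup>2 * \<nu> x) \<le> t * M"
        using bound[of n] \<open>0 < t\<close> by (intro mult_left_mono) simp_all
      ultimately show ?thesis by linarith
    qed
    have ab: "\<bar>h x * g n x * \<nu> x\<bar> \<le> ?b x" for x
    proof -
      have "\<bar>h x * g n x\<bar> \<le> inverse t * (h x)\<^sup>2 + t * (g n x)\<^sup>2"
      proof -
        have sq: "(sqrt t)\<^sup>2 = t" and "sqrt t \<noteq> 0" using \<open>0 < t\<close> by simp_all
        then have "inverse (sqrt t) * \<bar>h x\<bar> * (sqrt t * \<bar>g n x\<bar>) = \<bar>h x * g n x\<bar>"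
          by (simp only: abs_mult field_simps) simp
        then have "2 * \<bar>h x * g n x\<bar> \<le> inverse t * (h x)\<^sup>2 + t * (g n x)\<^sup>2"
          using sum_squares_bound[of "inverse (sqrt t) * \<bar>h x\<bar>" "sqrt t * \<bar>g n x\<bar>"]
          unfolding power_mult_distrib power_inverse power2_abs sq by linarith
        then show ?thesis by simp
      qed
      then have "\<bar>h x * g n x\<bar> * \<nu> x \<le> (inverse t * (h x)\<^sup>2 + t * (g n x)\<^sup>2) * \<nu> x"
        using \<nu> by (rule mult_right_mono)
      then show ?thesis using \<nu>[of x] by (simp add: abs_mult algebra_simps)
    qed
    have "\<bar>\<Sum>\<^sub>\<infinity>x\<in>-F. h x * g n x * \<nu> x\<bar> \<le> infsum ?b (-F)"
      by (rule norm_infsum_le[OF has_sum_infsum[OF s(1)] has_sum_infsum[OF b], simplified]) (use ab in simp)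
    then show ?thesis using split infb n0[OF that] tM \<open>0 < e\<close> by linarith
  qed
  then show "\<exists>no. \<forall>n\<ge>no. norm (inner_wrt UNIV \<nu> h (g n) - 0) < e" by auto
qed

section \<open>Reversible kernels with finite rows\<close>

text \<open>
  Operators act on all real functions, also on those outside \<open>L\<^sup>2\<close>. An operator whose values
  are finitary functionals is given by a matrix with finite rows, which makes it determined by its
  action on indicators.
\<close>

definition finitary :: "(('s \<Rightarrow> real) \<Rightarrow> real) \<Rightarrow> bool" where
  "finitary L \<longleftrightarrow> (\<exists>F c. finite F \<and> (\<forall>f. L f = (\<Sum>y\<in>F. c y * f y)))"

text \<open>
  The weight \<open>\<nu>\<close> may vanish at some states, as the stationary distribution of a network does at
  sets of nodes that cannot break down together.
\<close>

locale reversible_kernel =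
  fixes \<nu> :: "'s \<Rightarrow> real" and K :: "('s \<Rightarrow> real) \<Rightarrow> 's \<Rightarrow> real"
  assumes weight_nonneg: "0 \<le> \<nu> x"
    and stochastic: "stochastic_operator K"
    and finitary: "finitary (\<lambda>f. K f x)"
    and detailed_balance: "\<nu> x * K (indicator {y}) x = \<nu> y * K (indicator {x}) y"
begin

abbreviation ip :: "('s \<Rightarrow> real) \<Rightarrow> ('s \<Rightarrow> real) \<Rightarrow> real" where
  "ip \<equiv> inner_wrt UNIV \<nu>"

definition p :: "'s \<Rightarrow> 's \<Rightarrow> real" where
  "p x y = K (indicator {y}) x"

definition nbrs :: "'s \<Rightarrow> 's set" where
  "nbrs x = {y. p x y \<noteq> 0}"

definition flow :: "'s \<Rightarrow> 's \<Rightarrow> real" where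
  "flow x y = \<nu> x * p x y"

lemma p_nonneg: "0 \<le> p x y"
  using stochastic by (simp add: stochastic_operator_def p_def)

lemma flow_nonneg: "0 \<le> flow x y"
  by (simp add: flow_def p_nonneg weight_nonneg)

lemma flow_commute: "flow x y = flow y x"
  using detailed_balance by (simp add: flow_def p_def)

lemma finite_nbrs: "finite (nbrs x)"
  and K_eq: "K f x = (\<Sum>y\<in>nbrs x. p x y * f y)"
proof -
  obtain F c where F: "finite F" "\<And>f. K f x = (\<Sum>y\<in>F. c y * f y)"
    using finitary[of x] by (auto simp: finitary_def)
  have p: "p x y = (if y \<in> F then c y else 0)" for y
    using F by (simp add: p_def indicator_def of_bool_def if_distrib cong: if_cong)
  then have sub: "nbrs x \<subseteq> F" by (auto simp: nbrs_def split: if_splits)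
  then show "finite (nbrs x)" using F(1) by (rule finite_subset)
  have "K f x = (\<Sum>y\<in>F. p x y * f y)" using F(2) p by simp
  also have "\<dots> = (\<Sum>y\<in>nbrs x. p x y * f y)"
    using sub F(1) by (intro sum.mono_neutral_right) (auto simp: nbrs_def)
  finally show "K f x = (\<Sum>y\<in>nbrs x. p x y * f y)" .
qed

lemma has_sum_p_mult: "((\<lambda>y. p x y * f y) has_sum K f x) UNIV"
proof -
  have "((\<lambda>y. p x y * f y) has_sum K f x) (nbrs x)"
    using finite_nbrs by (simp add: K_eq)
  then show ?thesis
    by (rule has_sum_cong_neutral[THEN iffD1, rotated -1]) (auto simp: nbrs_def)
qed

lemma sum_p_nbrs: "(\<Sum>y\<in>nbrs x. p x y) = 1"
proof -
  have "((\<lambda>y. p x y) has_sum 1) UNIV"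
    using stochastic by (simp add: stochastic_operator_def p_def)
  moreover have "((\<lambda>y. p x y) has_sum K (\<lambda>_. 1) x) UNIV"
    using has_sum_p_mult[of x "\<lambda>_. 1"] by simp
  ultimately have "K (\<lambda>_. 1) x = 1" using has_sum_unique by blast
  then show ?thesis by (simp add: K_eq)
qed

lemma has_sum_flow_mult: "((\<lambda>y. flow x y * f y) has_sum \<nu> x * K f x) UNIV"
  using has_sum_cmult_right[OF has_sum_p_mult, of "\<nu> x"] by (simp add: flow_def mult.assoc)

lemma has_sum_flow: "((\<lambda>y. flow x y) has_sum \<nu> x) UNIV"
  using has_sum_flow_mult[of x "\<lambda>_. 1"] by (simp add: K_eq sum_p_nbrs)

text \<open>
  The flow is a symmetric measure on pairs of states and both its marginals are \<open>\<nu>\<close>. Functions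
  in \<open>L\<^sup>2(\<nu>)\<close> therefore turn into square-integrable functions of either coordinate.
\<close>

lemma has_sum_flow_fst:
  assumes "f \<in> L2 \<nu>"
  shows "((\<lambda>(x, y). (f x)\<^sup>2 * flow x y) has_sum ip f f) UNIV"
proof -
  have s: "((\<lambda>y. (f x)\<^sup>2 * flow x y) has_sum (f x)\<^sup>2 * \<nu> x) UNIV" for x
    by (rule has_sum_cmult_right[OF has_sum_flow])
  have f: "(\<lambda>x. (f x)\<^sup>2 * \<nu> x) summable_on UNIV"
    using assms by (simp add: L2_def)
  have sm: "(\<lambda>(x, y). (f x)\<^sup>2 * flow x y) summable_on UNIV \<times> UNIV"
    by (rule summable_on_SigmaI[OF _ f]) (auto simp: flow_nonneg s)
  have "((\<lambda>x. (f x)\<^sup>2 * \<nu> x) has_sum ip f f) UNIV"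
    using has_sum_infsum[OF f] by (simp add: inner_wrt_def power2_eq_square)
  then have "((\<lambda>(x, y). (f x)\<^sup>2 * flow x y) has_sum ip f f) (UNIV \<times> UNIV)"
    by (intro has_sum_SigmaI[OF _ _ sm]) (auto simp: s)
  then show ?thesis by simp
qed

lemma has_sum_flow_swap:
  fixes G :: "'s \<Rightarrow> 's \<Rightarrow> real"
  assumes "((\<lambda>(x, y). G x y * flow x y) has_sum S) UNIV"
  shows "((\<lambda>(x, y). G y x * flow x y) has_sum S) UNIV"
  using assms has_sum_swap[of "\<lambda>(x, y). G x y * flow x y" UNIV UNIV S]
  by (simp add: flow_commute case_prod_unfold)

lemma has_sum_flow_snd:
  assumes "f \<in> L2 \<nu>"
  shows "((\<lambda>(x, y). (f y)\<^sup>2 * flow x y) has_sum ip f f) UNIV"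
  using has_sum_flow_swap[OF has_sum_flow_fst[OF assms]] .

text \<open>
  Jensen's inequality for the probability vectors \<open>p x\<close>, in the form that the variance of \<open>f\<close>
  under \<open>p x\<close> is nonnegative.
\<close>

lemma K_square_le: "(K f x)\<^sup>2 \<le> K (\<lambda>y. (f y)\<^sup>2) x"
proof -
  let ?m = "K f x"
  have "0 \<le> (\<Sum>y\<in>nbrs x. p x y * (f y - ?m)\<^sup>2)"
    by (intro sum_nonneg mult_nonneg_nonneg p_nonneg) auto
  also have "\<dots> = (\<Sum>y\<in>nbrs x. p x y * (f y)\<^sup>2) - 2 * ?m * (\<Sum>y\<in>nbrs x. p x y * f y)
      + ?m\<^sup>2 * (\<Sum>y\<in>nbrs x. p x y)"
    by (simp add: power2_diff algebra_simps sum.distrib sum_subtractf sum_distrib_left)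
      (simp add: sum_distrib_right)
  also have "\<dots> = K (\<lambda>y. (f y)\<^sup>2) x - ?m\<^sup>2"
    by (simp add: sum_p_nbrs flip: K_eq) (simp add: power2_eq_square)
  finally show ?thesis by simp
qed

lemma K_L2: "f \<in> L2 \<nu> \<Longrightarrow> K f \<in> L2 \<nu>"
  and ip_K_K_le: "f \<in> L2 \<nu> \<Longrightarrow> ip (K f) (K f) \<le> ip f f"
proof -
  assume f: "f \<in> L2 \<nu>"
  have "((\<lambda>(x, y). (f y)\<^sup>2 * flow x y) has_sum ip f f) (UNIV \<times> UNIV)"
    using has_sum_flow_snd[OF f] by simp
  then have bound: "((\<lambda>x. K (\<lambda>y. (f y)\<^sup>2) x * \<nu> x) has_sum ip f f) UNIV"
    by (rule has_sum_SigmaD) (use has_sum_flow_mult[of _ "\<lambda>y. (f y)\<^sup>2"] in \<open>simp add: mult.commute\<close>)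
  have le: "(K f x)\<^sup>2 * \<nu> x \<le> K (\<lambda>y. (f y)\<^sup>2) x * \<nu> x" for x
    by (intro mult_right_mono K_square_le weight_nonneg)
  have s: "(\<lambda>x. (K f x)\<^sup>2 * \<nu> x) summable_on UNIV"
    by (rule summable_on_comparison_test[OF has_sum_imp_summable[OF bound] le])
      (simp add: weight_nonneg)
  then show "K f \<in> L2 \<nu>" by (simp add: L2_def)
  show "ip (K f) (K f) \<le> ip f f"
    using has_sum_mono[OF has_sum_infsum[OF s] bound le]
    by (simp add: inner_wrt_def power2_eq_square)
qed

text \<open>
  The product \<open>f x * g y\<close> is summable because each factor is square-summable against the flow, so
  the sum over pairs may be evaluated row by row. Self-adjointness of \<open>K\<close> is then the symmetry of
  the flow.
\<close>

lemma has_sum_flow_ip: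
  assumes "f \<in> L2 \<nu>" "g \<in> L2 \<nu>"
  shows "((\<lambda>(x, y). f x * g y * flow x y) has_sum ip f (K g)) UNIV"
proof -
  let ?F = "\<lambda>(x, y). f x * g y * flow x y"
  have "(\<lambda>z. f (fst z) * g (snd z) * flow (fst z) (snd z)) summable_on UNIV"
    using has_sum_imp_summable[OF has_sum_flow_fst[OF assms(1)]]
      has_sum_imp_summable[OF has_sum_flow_snd[OF assms(2)]]
    by (intro weighted_product_summable) (auto simp: flow_nonneg case_prod_unfold)
  then have s: "?F summable_on UNIV \<times> UNIV" by (simp add: case_prod_unfold)
  then have "(?F has_sum infsum ?F UNIV) (UNIV \<times> UNIV)"
    using has_sum_infsum by fastforce
  then have "((\<lambda>x. f x * K g x * \<nu> x) has_sum infsum ?F UNIV) UNIV"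
  proof (rule has_sum_SigmaD)
    fix x
    show "((\<lambda>y. case (x, y) of (x, y) \<Rightarrow> f x * g y * flow x y) has_sum f x * K g x * \<nu> x) UNIV"
      using has_sum_cmult_right[OF has_sum_flow_mult[of x g], of "f x"] by (simp add: mult_ac)
  qed
  then have "infsum ?F UNIV = ip f (K g)"
    unfolding inner_wrt_def by (rule infsumI[symmetric])
  then show ?thesis using has_sum_infsum[OF s] by simp
qed

lemma ip_K_right:
  assumes "f \<in> L2 \<nu>" "g \<in> L2 \<nu>"
  shows "ip f (K g) = ip (K f) g"
proof -
  have "((\<lambda>(x, y). f y * g x * flow x y) has_sum ip f (K g)) UNIV"
    by (rule has_sum_flow_swap[OF has_sum_flow_ip[OF assms]])
  moreover have "((\<lambda>(x, y). f y * g x * flow x y) has_sum ip g (K f)) UNIV"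
    using has_sum_flow_ip[OF assms(2,1)] by (simp add: mult.commute mult.left_commute)
  ultimately have "ip f (K g) = ip g (K f)" using has_sum_unique by blast
  then show ?thesis by (simp add: inner_wrt_commute)
qed

text \<open>
  The quadratic forms of \<open>Id + K\<close> and \<open>Id - K\<close>, for \<open>s = 1\<close> and \<open>s = -1\<close>, as sums of squares.
\<close>

lemma has_sum_flow_form:
  assumes "f \<in> L2 \<nu>" "s\<^sup>2 = 1"
  shows "((\<lambda>(x, y). (f x + s * f y)\<^sup>2 * flow x y) has_sum 2 * (ip f f + s * ip f (K f))) UNIV"
proof -
  have "((\<lambda>(x, y). (f x)\<^sup>2 * flow x y + (f y)\<^sup>2 * flow x y + 2 * s * (f x * f y * flow x y))
      has_sum ip f f + ip f f + 2 * s * ip f (K f)) UNIV"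
    using has_sum_add[OF has_sum_add[OF has_sum_flow_fst has_sum_flow_snd]
        has_sum_cmult_right[OF has_sum_flow_ip[of f f], of "2 * s"], OF assms(1,1,1,1)]
    by (simp add: case_prod_unfold)
  moreover have "(f x + s * f y)\<^sup>2 * flow x y
      = (f x)\<^sup>2 * flow x y + (f y)\<^sup>2 * flow x y + 2 * s * (f x * f y * flow x y)" for x y
    using assms(2) by (simp add: power2_sum power_mult_distrib algebra_simps)
  ultimately show ?thesis by (simp add: algebra_simps)
qed

lemma form_minus_nonneg: "f \<in> L2 \<nu> \<Longrightarrow> ip f (K f) \<le> ip f f"
  using has_sum_nonneg[OF has_sum_flow_form[of f "-1"]] by (auto simp: flow_nonneg)

lemma form_plus_ge:
  assumes "f \<in> L2 \<nu>"
  shows "(f x + f y)\<^sup>2 * flow x y \<le> 2 * (ip f f + ip f (K f))"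
  using finite_sum_le_has_sum[OF has_sum_flow_form[of f 1], of "{(x, y)}"] assms
  by (auto simp: flow_nonneg)

lemma form_plus_nonneg: "f \<in> L2 \<nu> \<Longrightarrow> 0 \<le> ip f f + ip f (K f)"
  using has_sum_nonneg[OF has_sum_flow_form[of f 1]] by (auto simp: flow_nonneg)

lemma K_diff: "K (\<lambda>x. f x - g x) = (\<lambda>x. K f x - K g x)"
  by (rule ext) (simp add: K_eq algebra_simps sum_subtractf)

lemma K_sum: "K (\<lambda>x. \<Sum>i\<in>I. F i x) = (\<lambda>x. \<Sum>i\<in>I. K (F i) x)"
  by (rule ext) (simp add: K_eq sum_distrib_left sum.swap[of _ I])

lemma funpow_L2: "f \<in> L2 \<nu> \<Longrightarrow> (K ^^ n) f \<in> L2 \<nu>"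
  by (induction n) (auto intro: K_L2)

lemma ip_funpow:
  assumes "f \<in> L2 \<nu>"
  shows "ip ((K ^^ i) f) ((K ^^ j) f) = ip f ((K ^^ (i + j)) f)"
proof (induction i arbitrary: j)
  case (Suc i)
  have "ip ((K ^^ Suc i) f) ((K ^^ j) f) = ip ((K ^^ i) f) ((K ^^ Suc j) f)"
    using ip_K_right[OF funpow_L2[OF assms, of i] funpow_L2[OF assms, of j]] by simp
  then show ?case using Suc[of "Suc j"] by simp
qed simp

section \<open>Autocovariances and truncated potentials\<close>

definition autocov :: "('s \<Rightarrow> real) \<Rightarrow> nat \<Rightarrow> real" where
  "autocov f k = ip f ((K ^^ k) f)"

definition autocov_sum :: "('s \<Rightarrow> real) \<Rightarrow> nat \<Rightarrow> real" where
  "autocov_sum f n = (\<Sum>k<n. autocov f k)"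

text \<open>
  A partial sum of the Neumann series for the solution \<open>h\<close> of the Poisson equation
  \<open>h - K h = f\<close>. The full series need not converge, and \<open>1\<close> need not be isolated in the spectrum of
  \<open>K\<close>, so all estimates below use the partial sums, for which the equation has the error
  \<open>(K ^^ n) f\<close>.
\<close>

definition truncated_potential :: "('s \<Rightarrow> real) \<Rightarrow> nat \<Rightarrow> 's \<Rightarrow> real" where
  "truncated_potential f n x = (\<Sum>k<n. (K ^^ k) f x)"

lemma truncated_potential_L2: "f \<in> L2 \<nu> \<Longrightarrow> truncated_potential f n \<in> L2 \<nu>"
  unfolding truncated_potential_def[abs_def]
  by (intro L2_sum) (auto simp: weight_nonneg intro: funpow_L2)

lemma truncated_potential_telescope:
  "truncated_potential f n x - K (truncated_potential f n) x = f x - (K ^^ n) f x"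
proof -
  have "K (truncated_potential f n) x = (\<Sum>k<n. (K ^^ Suc k) f x)"
    unfolding truncated_potential_def[abs_def] by (simp add: K_sum)
  then show ?thesis
    using sum_lessThan_telescope'[of "\<lambda>k. (K ^^ k) f x" n]
    by (simp add: truncated_potential_def sum_subtractf)
qed

definition dirichlet :: "('s \<Rightarrow> real) \<Rightarrow> ('s \<Rightarrow> real) \<Rightarrow> real" where
  "dirichlet f g = ip f g - ip f (K g)"

lemma ip_truncated_potential:
  assumes "f \<in> L2 \<nu>"
  shows "ip ((K ^^ m) f) (truncated_potential f n) = autocov_sum f (m + n) - autocov_sum f m"
proof -
  have "ip ((K ^^ m) f) (truncated_potential f n) = (\<Sum>k<n. autocov f (m + k))"
    unfolding truncated_potential_def[abs_def]
    by (subst inner_wrt_sum_right)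
      (simp_all add: weight_nonneg funpow_L2 assms ip_funpow autocov_def)
  also have "\<dots> = autocov_sum f (m + n) - autocov_sum f m"
    by (induction n) (simp_all add: autocov_sum_def)
  finally show ?thesis .
qed

lemma dirichlet_truncated_potential:
  assumes "f \<in> L2 \<nu>" "h \<in> L2 \<nu>"
  shows "dirichlet h (truncated_potential f n) = ip h f - ip h ((K ^^ n) f)"
proof -
  have "dirichlet h (truncated_potential f n)
      = ip h (\<lambda>x. truncated_potential f n x - K (truncated_potential f n) x)"
    unfolding dirichlet_def using assms truncated_potential_L2
    by (subst inner_wrt_diff_right) (auto simp: weight_nonneg intro: K_L2)
  also have "\<dots> = ip h f - ip h ((K ^^ n) f)"
    using assms by (simp add: truncated_potential_telescope inner_wrt_diff_right weight_nonneg funpow_L2)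
  finally show ?thesis .
qed

lemma dirichlet_truncated_potential_self:
  assumes "f \<in> L2 \<nu>"
  shows "dirichlet (truncated_potential f n) (truncated_potential f n)
    = 2 * autocov_sum f n - autocov_sum f (2 * n)"
proof -
  have "ip (truncated_potential f n) f = autocov_sum f n"
    using ip_truncated_potential[OF assms, of 0 n]
    by (simp add: inner_wrt_commute[of _ _ _ f]) (simp add: autocov_sum_def)
  moreover have "ip (truncated_potential f n) ((K ^^ n) f) = autocov_sum f (2 * n) - autocov_sum f n"
    using ip_truncated_potential[OF assms, of n n]
    by (simp add: inner_wrt_commute[of _ _ _ "(K ^^ n) f"] mult_2)
  ultimately show ?thesis
    using dirichlet_truncated_potential[OF assms truncated_potential_L2[OF assms], of n n] by simp
qed

text \<open>
  For an invertible \<open>Id - K\<close> the sum of all autocovariances would be the maximum over \<open>h\<close> of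
  \<open>2 * ip h f - dirichlet h h\<close>, attained at the potential of \<open>f\<close>. The finite version
  follows by expanding the nonnegative number \<open>dirichlet u u\<close> for
  \<open>u = h - truncated_potential f n\<close>.
\<close>

lemma potential_variational_bound:
  assumes f: "f \<in> L2 \<nu>" and h: "h \<in> L2 \<nu>"
  shows "2 * ip h f - dirichlet h h
    \<le> 2 * ip h ((K ^^ n) f) + (2 * autocov_sum f n - autocov_sum f (2 * n))"
proof -
  let ?g = "truncated_potential f n"
  let ?u = "\<lambda>x. h x - ?g x"
  note g = truncated_potential_L2[OF f, of n]
  note L = K_L2[OF h] K_L2[OF g]
  have u: "?u \<in> L2 \<nu>" by (intro L2_diff weight_nonneg h g)
  have diff_left: "ip ?u v = ip h v - ip ?g v" if "v \<in> L2 \<nu>" for v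
    using inner_wrt_diff_right[OF weight_nonneg h g that] by (simp add: inner_wrt_commute)
  have "ip ?u ?u = ip h h - 2 * ip h ?g + ip ?g ?g"
    using h g by (simp add: diff_left u inner_wrt_diff_right weight_nonneg inner_wrt_commute[of _ _ ?g h])
  moreover have "ip ?u (K ?u) = ip h (K h) - 2 * ip h (K ?g) + ip ?g (K ?g)"
    using h g L ip_K_right[OF g h]
    by (simp add: diff_left K_diff L2_diff inner_wrt_diff_right weight_nonneg
        inner_wrt_commute[of _ _ "K ?g" h])
  ultimately have "0 \<le> dirichlet h h - 2 * dirichlet h ?g + dirichlet ?g ?g"
    using form_minus_nonneg[OF u] by (simp add: dirichlet_def)
  then show ?thesis
    by (simp add: dirichlet_truncated_potential[OF f h] dirichlet_truncated_potential_self[OF f])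
qed

lemma ip_funpow_le:
  assumes "f \<in> L2 \<nu>"
  shows "ip ((K ^^ n) f) ((K ^^ n) f) \<le> ip f f"
proof (induction n)
  case (Suc n)
  then show ?case using ip_K_K_le[OF funpow_L2[OF assms], of n] by simp
qed simp

lemma autocov_even_nonneg:
  assumes "f \<in> L2 \<nu>"
  shows "0 \<le> autocov f (2 * k)"
  using ip_funpow[OF assms, of k k] inner_wrt_self_nonneg[of \<nu> "(K ^^ k) f", OF weight_nonneg]
  by (simp add: autocov_def mult_2)

lemma autocov_sum_even_step:
  assumes "f \<in> L2 \<nu>"
  shows "autocov_sum f (2 * Suc k) - autocov_sum f (2 * k)
    = ip ((K ^^ k) f) ((K ^^ k) f) + ip ((K ^^ k) f) (K ((K ^^ k) f))"
  using ip_funpow[OF assms, of k k] ip_funpow[OF assms, of k "Suc k"]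
  by (simp add: autocov_sum_def autocov_def mult_2)

end

text \<open>
  Without the state \<open>x0\<close> with a positive holding probability, \<open>K\<close> could have the eigenvalue \<open>-1\<close>,
  and the series of autocovariances would oscillate.
\<close>

locale aperiodic_reversible_kernel = reversible_kernel +
  fixes x0
  assumes holding: "0 < flow x0 x0"
    and connected: "0 < \<nu> x \<Longrightarrow> (x0, x) \<in> {(y, z). 0 < flow y z}\<^sup>*"
begin

text \<open>
  Along an edge the sum \<open>g k x + g k y\<close> tends to \<open>0\<close>. The loop at \<open>x0\<close> starts the propagation.
\<close>

lemma pointwise_convergence:
  assumes g: "\<And>k. g k \<in> L2 \<nu>"
    and form: "(\<lambda>k. ip (g k) (g k) + ip (g k) (K (g k))) \<longlonglongrightarrow> 0"
    and x: "0 < \<nu> x"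
  shows "(\<lambda>k. g k x) \<longlonglongrightarrow> 0"
proof -
  have edge: "(\<lambda>k. g k y + g k z) \<longlonglongrightarrow> 0" if "0 < flow y z" for y z
  proof -
    let ?b = "\<lambda>k. 2 / flow y z * (ip (g k) (g k) + ip (g k) (K (g k)))"
    have b: "?b \<longlonglongrightarrow> 0" using tendsto_mult_right_zero[OF form] .
    have "(g k y + g k z)\<^sup>2 \<le> ?b k" for k
      using form_plus_ge[OF g, of k y z] that by (simp add: field_simps)
    then have "(\<lambda>k. (g k y + g k z)\<^sup>2) \<longlonglongrightarrow> 0"
      by (intro tendsto_sandwich[OF _ _ tendsto_const b]) simp_all
    then have "(\<lambda>k. sqrt ((g k y + g k z)\<^sup>2)) \<longlonglongrightarrow> sqrt 0" by (rule tendsto_real_sqrt)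
    then show ?thesis by (simp add: tendsto_rabs_zero_iff)
  qed
  have "(\<lambda>k. g k x0 / 2 + g k x0 / 2) \<longlonglongrightarrow> 0"
    using tendsto_divide[OF edge[OF holding] tendsto_const[of 2]] by (simp add: add_divide_distrib)
  then have start: "(\<lambda>k. g k x0) \<longlonglongrightarrow> 0" by simp
  show ?thesis
    using connected[OF x]
  proof (induction rule: rtrancl_induct)
    case base
    show ?case by (rule start)
  next
    case (step y z)
    then have "(\<lambda>k. (g k y + g k z) - g k y) \<longlonglongrightarrow> 0 - 0"
      by (intro tendsto_diff edge) auto
    then show ?case by simp
  qed
qed

text \<open>
  Two consecutive autocovariances, the first with even index, add up to a value of the nonnegative
  form of \<open>Id + K\<close>, so the partial sums of even length increase. If they stay bounded, the form
  tends to \<open>0\<close> along the iterates \<open>(K ^^ k) f\<close>, which therefore converge to \<open>0\<close> pointwise and weakly.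
  In particular the autocovariances tend to \<open>0\<close>, and the partial sums of odd length have the same
  limit. If the even partial sums are unbounded, the odd ones, which are not smaller than
  their predecessors, diverge as well.
\<close>

lemma autocov_sum_limit:
  assumes f: "f \<in> L2 \<nu>"
  obtains s :: ereal where "(\<lambda>n. ereal (autocov_sum f n)) \<longlonglongrightarrow> s"
    and "\<And>n. ereal (autocov_sum f (2 * n)) \<le> s"
    and "\<And>h. s \<noteq> \<infinity> \<Longrightarrow> h \<in> L2 \<nu> \<Longrightarrow> (\<lambda>n. ip h ((K ^^ n) f)) \<longlonglongrightarrow> 0"
proof -
  define T where "T n = autocov_sum f (2 * n)" for n
  have T_step: "T (Suc k) - T k = ip ((K ^^ k) f) ((K ^^ k) f) + ip ((K ^^ k) f) (K ((K ^^ k) f))" for k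
    unfolding T_def by (rule autocov_sum_even_step[OF f])
  have "T k \<le> T (Suc k)" for k
    using T_step[of k] form_plus_nonneg[OF funpow_L2[OF f, of k]] by linarith
  then have incT: "incseq T" by (rule incseq_SucI)
  define s where "s = (SUP n. ereal (T n))"
  have T_lim: "(\<lambda>n. ereal (T n)) \<longlonglongrightarrow> s"
    unfolding s_def using incT by (intro LIMSEQ_SUP) (simp add: incseq_def)
  have T_le: "ereal (T n) \<le> s" for n unfolding s_def by (rule SUP_upper) simp
  \<comment> \<open>A partial sum of odd length exceeds the one before it by a squared norm \<open>b n\<close>.\<close>
  define b where "b n = (if odd n then autocov f (n - 1) else 0)" for n
  have b_nonneg: "0 \<le> b n" for n
    using autocov_even_nonneg[OF f, of "n div 2"] by (auto simp: b_def elim!: oddE)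
  have split: "autocov_sum f n = T (n div 2) + b n" for n
    by (cases "even n") (auto simp: T_def b_def autocov_sum_def elim!: evenE oddE)
  have half: "filterlim (\<lambda>n::nat. n div 2) at_top at_top"
    unfolding filterlim_at_top
  proof
    fix m :: nat
    show "\<forall>\<^sub>F n in at_top. m \<le> n div 2"
      using eventually_ge_at_top[of "2 * m"] by eventually_elim linarith
  qed
  have T_half: "(\<lambda>n. ereal (T (n div 2))) \<longlonglongrightarrow> s"
    using filterlim_compose[OF T_lim half] .
  have weak: "(\<lambda>n. ip h ((K ^^ n) f)) \<longlonglongrightarrow> 0" if fin: "s \<noteq> \<infinity>" and h: "h \<in> L2 \<nu>" for h
  proof -
    obtain r where r: "s = ereal r"
      using T_le[of 0] fin by (cases s) auto
    have lim: "T \<longlonglongrightarrow> r" using T_lim by (simp add: r)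
    have "(\<lambda>k. T (Suc k) - T k) \<longlonglongrightarrow> r - r"
      by (intro tendsto_diff LIMSEQ_Suc lim)
    then have form: "(\<lambda>k. ip ((K ^^ k) f) ((K ^^ k) f) + ip ((K ^^ k) f) (K ((K ^^ k) f))) \<longlonglongrightarrow> 0"
      by (simp add: T_step)
    show ?thesis
      by (rule bounded_pointwise_imp_weak_convergence[where g = "\<lambda>n. (K ^^ n) f",
            OF weight_nonneg h funpow_L2[OF f] ip_funpow_le[OF f]])
        (rule pointwise_convergence[OF funpow_L2[OF f] form])
  qed
  have "(\<lambda>n. ereal (autocov_sum f n)) \<longlonglongrightarrow> s"
  proof (cases "s = \<infinity>")
    case True
    show ?thesis
      unfolding True tendsto_PInfty
    proof
      fix r
      have "\<forall>\<^sub>F n in sequentially. ereal r < ereal (T (n div 2))"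
        using T_half unfolding True tendsto_PInfty by blast
      then show "\<forall>\<^sub>F n in sequentially. ereal r < ereal (autocov_sum f n)"
      proof eventually_elim
        case (elim n)
        then show ?case using split[of n] b_nonneg[of n] by simp
      qed
    qed
  next
    case False
    obtain r where r: "s = ereal r"
      using T_le[of 0] False by (cases s) auto
    have a0: "(\<lambda>n. autocov f n) \<longlonglongrightarrow> 0"
      using weak[OF False f] by (simp add: autocov_def)
    have "(\<lambda>n. autocov f (n - 1)) \<longlonglongrightarrow> 0"
      using a0 filterlim_sequentially_Suc[of "\<lambda>n. autocov f (n - 1)" "nhds 0"] by simp
    then have "(\<lambda>n. \<bar>autocov f (n - 1)\<bar>) \<longlonglongrightarrow> 0" by (rule tendsto_rabs_zero)
    then have "b \<longlonglongrightarrow> 0"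
      by (rule Lim_null_comparison[rotated]) (simp add: b_def)
    then have "(\<lambda>n. T (n div 2) + b n) \<longlonglongrightarrow> r + 0"
      using T_half by (intro tendsto_add) (simp_all add: r)
    then show ?thesis by (simp add: r split)
  qed
  then show ?thesis using T_le weak unfolding T_def by (rule that)
qed

lemma suminf_autocov:
  assumes "(\<lambda>n. ereal (autocov_sum f n)) \<longlonglongrightarrow> s"
  shows "(\<Sum>k. ereal (ip f ((K ^^ Suc k) f))) = s + ereal (- autocov f 0)"
proof -
  have shift: "(\<Sum>k<n. autocov f (Suc k)) = autocov_sum f (Suc n) - autocov f 0" for n
    unfolding autocov_sum_def sum.lessThan_Suc_shift[of _ n] by (simp only: comp_def add_diff_cancel_left')
  have "(\<Sum>k<n. ereal (ip f ((K ^^ Suc k) f)))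
      = ereal (autocov_sum f (Suc n)) + ereal (- autocov f 0)" for n
  proof -
    have "(\<Sum>k<n. ereal (ip f ((K ^^ Suc k) f))) = ereal (\<Sum>k<n. autocov f (Suc k))"
      by (simp only: autocov_def sum_ereal)
    then show ?thesis by (simp only: shift plus_ereal.simps diff_conv_add_uminus)
  qed
  moreover have "(\<lambda>n. ereal (autocov_sum f (Suc n)) + ereal (- autocov f 0)) \<longlonglongrightarrow> s + ereal (- autocov f 0)"
    by (rule tendsto_add_ereal_general1[OF _ LIMSEQ_Suc[OF assms] tendsto_const]) simp
  ultimately have "(\<lambda>k. ereal (ip f ((K ^^ Suc k) f))) sums (s + ereal (- autocov f 0))"
    by (simp only: sums_def)
  then show ?thesis by (rule sums_unique[symmetric])
qed

end

section \<open>Comparison of two kernels\<close>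

text \<open>
  Restricting \<open>h\<close> to finite sets \<open>F\<close> of states approximates \<open>ip h (K h)\<close>, because the sum over
  pairs converges absolutely.
\<close>

lemma kernel_order_from_finite_support:
  assumes K: "reversible_kernel \<nu> K" and K': "reversible_kernel \<nu> K'"
    and order: "\<And>h. finite {x. h x \<noteq> 0} \<Longrightarrow> inner_wrt UNIV \<nu> h (K' h) \<le> inner_wrt UNIV \<nu> h (K h)"
    and h: "h \<in> L2 \<nu>"
  shows "inner_wrt UNIV \<nu> h (K' h) \<le> inner_wrt UNIV \<nu> h (K h)"
proof -
  interpret K: reversible_kernel \<nu> K by (rule K)
  interpret K': reversible_kernel \<nu> K' by (rule K')
  let ?G = "\<lambda>(x, y). h x * h y * (K.flow x y - K'.flow x y)"
  have G: "(?G has_sum (K.ip h (K h) - K.ip h (K' h))) UNIV"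
    using has_sum_add[OF K.has_sum_flow_ip[OF h h] has_sum_cmult_right[OF K'.has_sum_flow_ip[OF h h], of "-1"]]
    by (simp add: case_prod_unfold algebra_simps)
  have sq: "0 \<le> sum ?G (F \<times> F)" if F: "finite F" for F
  proof -
    let ?h = "\<lambda>x. if x \<in> F then h x else 0"
    have fin: "finite {x. ?h x \<noteq> 0}" using F by (rule finite_subset[rotated]) auto
    then have "(\<lambda>x. (?h x)\<^sup>2 * \<nu> x) summable_on UNIV"
      by (intro finite_nonzero_values_imp_summable_on) (rule finite_subset[OF _ fin], auto)
    then have hL: "?h \<in> L2 \<nu>" by (simp add: L2_def)
    have eq: "inner_wrt UNIV \<nu> ?h (R ?h) = (\<Sum>(x, y)\<in>F \<times> F. h x * h y * reversible_kernel.flow \<nu> R x y)"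
      if "reversible_kernel \<nu> R" for R
    proof -
      let ?G = "\<lambda>(x, y). h x * h y * reversible_kernel.flow \<nu> R x y"
      have "((\<lambda>(x, y). ?h x * ?h y * reversible_kernel.flow \<nu> R x y)
          has_sum inner_wrt UNIV \<nu> ?h (R ?h)) UNIV"
        by (rule reversible_kernel.has_sum_flow_ip[OF that hL hL])
      then have "(?G has_sum inner_wrt UNIV \<nu> ?h (R ?h)) (F \<times> F)"
        by (rule has_sum_cong_neutral[THEN iffD1, rotated -1]) (auto split: if_splits)
      then show ?thesis using F by (intro has_sum_unique[OF _ has_sum_finite]) auto
    qed
    have "0 \<le> (\<Sum>(x, y)\<in>F \<times> F. h x * h y * K.flow x y) - (\<Sum>(x, y)\<in>F \<times> F. h x * h y * K'.flow x y)"
      using order[OF fin] unfolding eq[OF K] eq[OF K'] by simp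
    then show ?thesis
      by (simp add: case_prod_unfold right_diff_distrib flip: sum_subtractf)
  qed
  show ?thesis
  proof (rule ccontr)
    assume less: "\<not> ?thesis"
    define e where "e = K.ip h (K' h) - K.ip h (K h)"
    have "0 < e" using less by (simp add: e_def)
    obtain X where X: "finite X" "\<And>Y. finite Y \<Longrightarrow> X \<subseteq> Y \<Longrightarrow> dist (sum ?G Y) (- e) < e"
      using tendstoD[OF G[unfolded has_sum_def] \<open>0 < e\<close>]
      by (auto simp: eventually_finite_subsets_at_top e_def)
    let ?F = "fst ` X \<union> snd ` X"
    have "X \<subseteq> ?F \<times> ?F" by (auto intro: rev_image_eqI)
    then have "dist (sum ?G (?F \<times> ?F)) (- e) < e" using X(1) by (intro X(2)) auto
    moreover have "0 \<le> sum ?G (?F \<times> ?F)" using X(1) by (intro sq) auto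
    ultimately show False by (simp add: dist_real_def)
  qed
qed

text \<open>
  If \<open>s\<close>, the sum of the autocovariances under \<open>K\<close>, is finite, the variational bound has the limit
  \<open>2 * ip h f - dirichlet h h \<le> s\<close>. The truncated potential \<open>h\<close> of \<open>f\<close> under \<open>K'\<close>, whose
  Dirichlet form only grows when \<open>K\<close> is replaced by \<open>K'\<close>, makes the left-hand side
  at least a partial sum under \<open>K'\<close>.
\<close>

theorem asymptotic_variance_antimono:
  assumes K: "aperiodic_reversible_kernel \<nu> K x0" and K': "aperiodic_reversible_kernel \<nu> K' x0'"
    and order: "\<And>h. finite {x. h x \<noteq> 0} \<Longrightarrow> inner_wrt UNIV \<nu> h (K' h) \<le> inner_wrt UNIV \<nu> h (K h)"
    and f: "f \<in> L2 \<nu>"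
  shows "asymptotic_variance \<nu> f K' \<le> asymptotic_variance \<nu> f K"
proof -
  interpret K: aperiodic_reversible_kernel \<nu> K x0 by (rule K)
  interpret K': aperiodic_reversible_kernel \<nu> K' x0' by (rule K')
  obtain s where s: "(\<lambda>n. ereal (K.autocov_sum f n)) \<longlonglongrightarrow> s"
    and weak: "\<And>h. s \<noteq> \<infinity> \<Longrightarrow> h \<in> L2 \<nu> \<Longrightarrow> (\<lambda>n. K.ip h ((K ^^ n) f)) \<longlonglongrightarrow> 0"
    and s_ge: "\<And>n. ereal (K.autocov_sum f (2 * n)) \<le> s"
    using K.autocov_sum_limit[OF f] by metis
  obtain s' where s': "(\<lambda>n. ereal (K'.autocov_sum f n)) \<longlonglongrightarrow> s'"
    using K'.autocov_sum_limit[OF f] by metis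
  have "s' \<le> s"
  proof (cases "s = \<infinity>")
    case False
    obtain r where r: "s = ereal r"
      using s_ge[of 0] False by (cases s) auto
    have lim: "K.autocov_sum f \<longlonglongrightarrow> r" using s by (simp add: r)
    have even: "filterlim (\<lambda>n::nat. 2 * n) at_top at_top"
      by (rule filterlim_subseq) (simp add: strict_mono_def)
    have "K'.autocov_sum f (2 * m) \<le> r" for m
    proof -
      let ?h = "K'.truncated_potential f m"
      have h: "?h \<in> L2 \<nu>" by (rule K'.truncated_potential_L2[OF f])
      have "(\<lambda>n. 2 * K.ip ?h ((K ^^ n) f) + (2 * K.autocov_sum f n - K.autocov_sum f (2 * n)))
          \<longlonglongrightarrow> 2 * 0 + (2 * r - r)"
        by (intro tendsto_intros lim weak[OF False h] filterlim_compose[OF lim even])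
      then have "2 * K.ip ?h f - K.dirichlet ?h ?h \<le> 2 * 0 + (2 * r - r)"
        by (rule LIMSEQ_le_const) (use K.potential_variational_bound[OF f h] in blast)
      moreover have "K.dirichlet ?h ?h \<le> K'.dirichlet ?h ?h"
        using kernel_order_from_finite_support[OF K.reversible_kernel_axioms
            K'.reversible_kernel_axioms order h]
        by (simp add: K.dirichlet_def K'.dirichlet_def)
      moreover have "K.ip ?h f = K'.autocov_sum f m"
        using K'.ip_truncated_potential[OF f, of 0 m]
        by (simp add: inner_wrt_commute[of _ _ _ f]) (simp add: K'.autocov_sum_def)
      ultimately show ?thesis
        using K'.dirichlet_truncated_potential_self[OF f, of m] by simp
    qed
    moreover have "(\<lambda>m. ereal (K'.autocov_sum f (2 * m))) \<longlonglongrightarrow> s'"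
      by (rule filterlim_compose[OF s' even])
    ultimately show ?thesis
      unfolding r by (intro LIMSEQ_le_const2[where X = "\<lambda>m. ereal (K'.autocov_sum f (2 * m))"]) auto
  qed simp
  moreover have "K'.autocov f 0 = K.autocov f 0"
    by (simp add: K.autocov_def K'.autocov_def)
  ultimately show ?thesis
    unfolding asymptotic_variance_def K.suminf_autocov[OF s] K'.suminf_autocov[OF s']
    by (intro add_left_mono ereal_mult_left_mono) (auto intro: add_right_mono)
qed

section \<open>The generator of an unreliable Jackson network\<close>

definition add_job :: "'j option \<Rightarrow> ('j \<Rightarrow> nat) \<Rightarrow> 'j \<Rightarrow> nat" where
  "add_job i n = (case i of None \<Rightarrow> n | Some j \<Rightarrow> plus_unit n j)"

definition remove_job :: "'j option \<Rightarrow> ('j \<Rightarrow> nat) \<Rightarrow> 'j \<Rightarrow> nat" where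
  "remove_job i n = (case i of None \<Rightarrow> n | Some j \<Rightarrow> minus_unit n j)"

definition job_rate :: "'j network \<Rightarrow> 'j option \<Rightarrow> ('j \<Rightarrow> nat) \<Rightarrow> real" where
  "job_rate N i n = (case i of None \<Rightarrow> arrival N | Some j \<Rightarrow> service N j (n j))"

lemma remove_add_job [simp]: "remove_job i (add_job i n) = n"
  by (auto simp: add_job_def remove_job_def plus_unit_def minus_unit_def split: option.split)

lemma add_job_eq_iff [simp]: "add_job i n = add_job j n \<longleftrightarrow> i = j"
proof
  assume eq: "add_job i n = add_job j n"
  have "add_job i n k = (if i = Some k then Suc (n k) else n k)" for i k
    by (auto simp: add_job_def plus_unit_def split: option.split)
  then have "i = Some k \<longleftrightarrow> j = Some k" for k
    using fun_cong[OF eq, of k] by (auto split: if_splits)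
  then show "i = j" by (metis not_Some_eq option.sel)
qed simp

lemma up_nodes_eq: "up_nodes D = insert None (Some ` (- D))"
  by (auto simp: up_nodes_def) (metis ComplI imageI not_Some_eq)

lemma sum_up_nodes:
  fixes D :: "('j::finite) set"
  shows "(\<Sum>i\<in>up_nodes D. F i) = F None + (\<Sum>j\<in>-D. F (Some j))"
  by (simp add: up_nodes_eq sum.reindex)

lemma finite_up_nodes [simp]: "finite (up_nodes (D :: ('j::finite) set))"
  by (simp add: up_nodes_eq)

lemma genY_eq: "genY N h D = (\<Sum>I\<in>UNIV. qY N D I * (h I - h D))"
  for N :: "('j::finite) network"
proof -
  have "(\<Sum>I\<in>UNIV. qY N D I * (h I - h D)) = (\<Sum>I\<in>{H. H \<subset> D} \<union> {I. D \<subset> I}. qY N D I * (h I - h D))"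
    by (rule sum.mono_neutral_right) (auto simp: qY_def)
  also have "\<dots> = genY N h D"
    unfolding genY_def by (rule sum.union_disjoint) auto
  finally show ?thesis by simp
qed

text \<open>
  Arrivals, departures and transfers become moves \<open>i \<rightarrow> j\<close> between up nodes once the source is
  treated as a node with the constant service rate \<open>arrival N\<close>. The move \<open>None \<rightarrow> None\<close> leaves the
  state unchanged and contributes \<open>0\<close>.
\<close>

definition gen_routing :: "('j::finite) network \<Rightarrow> 'j set \<Rightarrow> (('j \<Rightarrow> nat) \<Rightarrow> real) \<Rightarrow> ('j \<Rightarrow> nat) \<Rightarrow> real" where
  "gen_routing N D g n = (\<Sum>i\<in>up_nodes D. \<Sum>j\<in>up_nodes D.
     job_rate N i n * rerouting N D i j * (g (add_job j (remove_job i n)) - g n))"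

lemma genZ_eq: "genZ N f (D, n) = gen_routing N D (\<lambda>m. f (D, m)) n + genY N (\<lambda>I. f (I, n)) D"
  by (simp add: genZ_def gen_routing_def sum_up_nodes job_rate_def add_job_def remove_job_def
      sum.distrib sum_distrib_left mult.assoc)

lemma finitary_apply: "finitary (\<lambda>f. f x)"
  unfolding finitary_def by (intro exI[of _ "{x}"] exI[of _ "\<lambda>_. 1"]) simp

lemma finitary_cmult:
  assumes "finitary L"
  shows "finitary (\<lambda>f. c * L f)"
proof -
  obtain F d where "finite F" "\<And>f. L f = (\<Sum>y\<in>F. d y * f y)"
    using assms by (auto simp: finitary_def)
  then show ?thesis
    unfolding finitary_def
    by (intro exI[of _ F] exI[of _ "\<lambda>y. c * d y"]) (simp add: sum_distrib_left mult.assoc)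
qed

lemma finitary_add:
  assumes "finitary L" "finitary M"
  shows "finitary (\<lambda>f. L f + M f)"
proof -
  obtain F c where F: "finite F" "\<And>f. L f = (\<Sum>y\<in>F. c y * f y)"
    using assms(1) by (auto simp: finitary_def)
  obtain G d where G: "finite G" "\<And>f. M f = (\<Sum>y\<in>G. d y * f y)"
    using assms(2) by (auto simp: finitary_def)
  let ?c = "\<lambda>y. (if y \<in> F then c y else 0) + (if y \<in> G then d y else 0)"
  have "L f + M f = (\<Sum>y\<in>F \<union> G. ?c y * f y)" for f
  proof -
    have "L f = (\<Sum>y\<in>F \<union> G. (if y \<in> F then c y else 0) * f y)"
      unfolding F(2) using F(1) G(1) by (intro sum.mono_neutral_cong_left) auto
    moreover have "M f = (\<Sum>y\<in>F \<union> G. (if y \<in> G then d y else 0) * f y)"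
      unfolding G(2) using F(1) G(1) by (intro sum.mono_neutral_cong_left) auto
    ultimately show ?thesis by (simp add: distrib_right sum.distrib)
  qed
  then show ?thesis
    unfolding finitary_def using F(1) G(1) by (intro exI[of _ "F \<union> G"] exI[of _ ?c]) simp
qed

lemma finitary_diff: "finitary L \<Longrightarrow> finitary M \<Longrightarrow> finitary (\<lambda>f. L f - M f)"
  using finitary_add[of L "\<lambda>f. -1 * M f"] finitary_cmult[of M "-1"] by simp

lemma finitary_sum: "finite I \<Longrightarrow> (\<And>i. i \<in> I \<Longrightarrow> finitary (L i)) \<Longrightarrow> finitary (\<lambda>f. \<Sum>i\<in>I. L i f)"
proof (induction I rule: finite_induct)
  case empty
  then show ?case by (auto simp: finitary_def intro!: exI[of _ "{}"])
next
  case (insert i I)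
  then show ?case by (simp add: finitary_add)
qed

lemma finitary_genZ: "finitary (\<lambda>f. genZ N f x)"
proof (cases x)
  case (Pair D n)
  show ?thesis
    unfolding Pair genZ_eq gen_routing_def genY_eq
    by (intro finitary_add finitary_sum finitary_cmult finitary_diff finitary_apply) simp_all
qed

text \<open>A symmetric conductance \<open>W\<close> on a finite set defines a symmetric form.\<close>

lemma conductance_form_commute:
  fixes W :: "'i \<Rightarrow> 'i \<Rightarrow> real"
  assumes "\<And>i j. i \<in> U \<Longrightarrow> j \<in> U \<Longrightarrow> W i j = W j i"
  shows "(\<Sum>i\<in>U. \<Sum>j\<in>U. W i j * (u i * (v j - v i))) = (\<Sum>i\<in>U. \<Sum>j\<in>U. W i j * (v i * (u j - u i)))"
proof -
  have "(\<Sum>i\<in>U. \<Sum>j\<in>U. W i j * (u i * v j)) = (\<Sum>i\<in>U. \<Sum>j\<in>U. W i j * (v i * u j))"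
    by (subst sum.swap) (intro sum.cong refl, simp add: assms mult.commute)
  then show ?thesis
    by (simp add: right_diff_distrib sum_subtractf mult.commute[of "u _" "v _"])
qed

lemma finite_ennreal_quotient:
  assumes "ennreal a / ennreal 0 < \<infinity>" "0 \<le> a"
  shows "a = 0"
proof (rule ccontr)
  assume "a \<noteq> 0"
  then have "ennreal a \<noteq> 0" using assms(2) by (simp add: ennreal_eq_0_iff)
  then show False using assms(1) by (simp add: ennreal_divide_zero)
qed

lemma trancl_invariant:
  assumes "(a, b) \<in> R\<^sup>+" "P a" "\<And>x y. (x, y) \<in> R \<Longrightarrow> P x \<Longrightarrow> P y"
  shows "P b"
  using assms by (induction rule: trancl_induct) auto

locale jackson =
  fixes N :: "('j::finite) network"
  assumes network: "unreliable_jackson_network N"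
begin

abbreviation \<eta> :: "'j option \<Rightarrow> real" where "\<eta> \<equiv> throughput0 N"

lemma arrival_pos: "0 < arrival N"
  and irreducible: "(i, j) \<in> {(k, l). 0 < routing N k l}\<^sup>+"
  and service_0: "service N k 0 = 0"
  and service_pos: "1 \<le> m \<Longrightarrow> 0 < service N k m"
  and rerouting_nonneg: "i \<in> up_nodes D \<Longrightarrow> j \<in> up_nodes D \<Longrightarrow> 0 \<le> rerouting N D i j"
  and rerouting_row: "i \<in> up_nodes D \<Longrightarrow> (\<Sum>j\<in>up_nodes D. rerouting N D i j) = 1"
  and traffic: "k \<in> - D \<Longrightarrow> throughput N k = arrival N * rerouting N D None (Some k) +
        (\<Sum>i\<in>-D. throughput N i * rerouting N D (Some i) (Some k))"
  and stable: "summable (\<lambda>m. \<Prod>k=1..m. throughput N l / service N l k)"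
  and AB: "breakdown_repair_functions (breakdown N) (repair N)"
  using network unfolding unreliable_jackson_network_def irreducible_matrix_def stochastic_matrix_def
  by blast+

lemma up_nodes_empty [simp]: "up_nodes {} = UNIV"
  by (simp add: up_nodes_def)

text \<open>
  The vector \<open>\<eta>\<close> solves \<open>x = x R\<close>, hence so does \<open>\<bar>\<eta>\<bar>\<close>, since the total mass of
  \<open>\<bar>\<eta>\<bar> R - \<bar>\<eta>\<bar> \<ge> 0\<close> vanishes. Then \<open>\<bar>\<eta>\<bar> + \<eta>\<close> is a nonnegative solution which is positive
  at the source, and irreducibility spreads the positivity to every node.
\<close>

lemma throughput0_pos: "0 < \<eta> i"
proof -
  let ?r = "routing N"
  have r: "0 \<le> ?r k l" "(\<Sum>l\<in>UNIV. ?r k l) = 1" for k l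
    using rerouting_nonneg[of k "{}" l] rerouting_row[of k "{}"] by simp_all
  \<comment> \<open>Column sums weighted by \<open>x\<close> preserve the total mass, so the equation at \<open>None\<close> follows from the
    others.\<close>
  have total: "(\<Sum>l\<in>UNIV. \<Sum>k\<in>UNIV. x k * ?r k l) = (\<Sum>k\<in>UNIV. x k)" for x :: "'j option \<Rightarrow> real"
    by (subst sum.swap) (simp add: r flip: sum_distrib_left)
  have node: "\<eta> (Some l) = (\<Sum>k\<in>UNIV. \<eta> k * ?r k (Some l))" for l
    using traffic[of l "{}"] sum_up_nodes[of "\<lambda>k. \<eta> k * ?r k (Some l)" "{}"]
    by (simp add: throughput0_def)
  have "\<eta> None = (\<Sum>k\<in>UNIV. \<eta> k * ?r k None)"
    using total[of \<eta>] sum_up_nodes[of \<eta> "{}"] sum_up_nodes[of "\<lambda>l. \<Sum>k\<in>UNIV. \<eta> k * ?r k l" "{}"]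
    by (simp flip: node)
  then have inv: "\<eta> l = (\<Sum>k\<in>UNIV. \<eta> k * ?r k l)" for l
    using node by (cases l) auto
  have "\<bar>\<eta> l\<bar> \<le> (\<Sum>k\<in>UNIV. \<bar>\<eta> k\<bar> * ?r k l)" for l
    using sum_abs[of "\<lambda>k. \<eta> k * ?r k l" UNIV] by (simp add: abs_mult r flip: inv)
  then have gap: "0 \<le> (\<Sum>k\<in>UNIV. \<bar>\<eta> k\<bar> * ?r k l) - \<bar>\<eta> l\<bar>" for l by simp
  have "(\<Sum>l\<in>UNIV. (\<Sum>k\<in>UNIV. \<bar>\<eta> k\<bar> * ?r k l) - \<bar>\<eta> l\<bar>) = 0"
    by (simp add: sum_subtractf total)
  then have abs_inv: "(\<Sum>k\<in>UNIV. \<bar>\<eta> k\<bar> * ?r k l) - \<bar>\<eta> l\<bar> = 0" for l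
    using sum_nonneg_0[of UNIV "\<lambda>l. (\<Sum>k\<in>UNIV. \<bar>\<eta> k\<bar> * ?r k l) - \<bar>\<eta> l\<bar>" l] gap by simp
  define y where "y k = \<bar>\<eta> k\<bar> + \<eta> k" for k
  have y_nonneg: "0 \<le> y k" for k by (simp add: y_def abs_if)
  have y_inv: "y l = (\<Sum>k\<in>UNIV. y k * ?r k l)" for l
    using abs_inv[of l] inv[of l] by (simp add: y_def distrib_right sum.distrib)
  have "0 < y l" if "0 < ?r k l" "0 < y k" for k l
  proof -
    have "y k * ?r k l \<le> y l"
      unfolding y_inv[of l] by (rule member_le_sum) (simp_all add: y_nonneg r)
    then show ?thesis using mult_pos_pos[OF that(2,1)] by linarith
  qed
  moreover have "0 < y None" using arrival_pos by (simp add: y_def throughput0_def)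
  ultimately have "0 < y i"
    using trancl_invariant[OF irreducible[of None i], of "\<lambda>k. 0 < y k"] by auto
  then show ?thesis by (simp add: y_def abs_if split: if_splits)
qed

lemma throughput_pos: "0 < throughput N k"
  using throughput0_pos[of "Some k"] by (simp add: throughput0_def)

lemma pi_network_pos: "0 < pi_network N n"
proof -
  have "0 < (\<Prod>k=1..m. throughput N l / service N l k)" for l m
    by (intro prod_pos) (simp add: throughput_pos service_pos)
  then have "0 < inverse (\<Sum>m. \<Prod>k=1..m. throughput N l / service N l k)
      * (\<Prod>k=1..n l. throughput N l / service N l k)" for l
    using suminf_pos[OF stable[of l]] by (intro mult_pos_pos) simp_all
  then show ?thesis unfolding pi_network_def by (intro prod_pos) blast
qed

lemma job_rate_nonneg: "0 \<le> job_rate N i n"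
proof -
  have "0 \<le> service N k m" for k m
    using service_0[of k] service_pos[of m k] by (cases m) (simp_all add: less_imp_le)
  then show ?thesis
    using arrival_pos by (simp add: job_rate_def split: option.split)
qed

lemma job_rate_add_job_pos: "0 < job_rate N i (add_job i n)"
  using arrival_pos service_pos
  by (auto simp: job_rate_def add_job_def plus_unit_def split: option.split)

text \<open>Adding a job at node \<open>i\<close> and serving it are in detailed balance.\<close>

lemma pi_network_add_job:
  "pi_network N (add_job i n) * job_rate N i (add_job i n) = pi_network N n * \<eta> i"
proof (cases i)
  case None
  then show ?thesis by (simp add: add_job_def job_rate_def throughput0_def)
next
  case (Some j)
  let ?w = "\<lambda>n l. inverse (\<Sum>m. \<Prod>k=1..m. throughput N l / service N l k) *
        (\<Prod>k=1..n l. throughput N l / service N l k)"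
  let ?n = "plus_unit n j"
  have "pi_network N n = ?w n j * (\<Prod>l\<in>UNIV - {j}. ?w n l)" for n
    unfolding pi_network_def by (rule prod.remove) simp_all
  note this[of ?n] this[of n]
  moreover have "(\<Prod>l\<in>UNIV - {j}. ?w ?n l) = (\<Prod>l\<in>UNIV - {j}. ?w n l)"
    by (rule prod.cong) (simp_all add: plus_unit_def)
  moreover have "?w ?n j = ?w n j * (throughput N j / service N j (Suc (n j)))"
    by (simp add: plus_unit_def)
  ultimately show ?thesis
    using service_pos[of "Suc (n j)" j]
    by (simp add: Some add_job_def job_rate_def throughput0_def) (simp add: plus_unit_def)
qed

lemma breakdown_nonneg: "0 \<le> breakdown N D" and repair_nonneg: "0 \<le> repair N D"
  and breakdown_empty: "breakdown N {} = 1" and repair_empty: "repair N {} = 1"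
  using AB unfolding breakdown_repair_functions_def by blast+

lemma breakdown_0: "D \<subset> I \<Longrightarrow> breakdown N D = 0 \<Longrightarrow> breakdown N I = 0"
proof (rule finite_ennreal_quotient)
  assume "D \<subset> I" and zero: "breakdown N D = 0"
  then have "ennreal (breakdown N I) / ennreal (breakdown N D) < \<infinity>"
    using AB unfolding breakdown_repair_functions_def by blast
  then show "ennreal (breakdown N I) / ennreal 0 < \<infinity>" by (simp only: zero)
qed (rule breakdown_nonneg)

lemma repair_0: "repair N D = 0 \<Longrightarrow> breakdown N D = 0"
proof (rule finite_ennreal_quotient)
  assume zero: "repair N D = 0"
  have "ennreal (breakdown N D) / ennreal (repair N D) < \<infinity>"
    using AB unfolding breakdown_repair_functions_def by blast
  then show "ennreal (breakdown N D) / ennreal 0 < \<infinity>" by (simp only: zero)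
qed (rule breakdown_nonneg)

lemma pi_hat_nonneg: "0 \<le> pi_hat N D"
  unfolding pi_hat_def
  by (intro mult_nonneg_nonneg) (simp_all add: sum_nonneg breakdown_nonneg repair_nonneg)

lemma pi_hat_empty_pos: "0 < pi_hat N {}"
proof -
  have "breakdown N {} / repair N {} \<le> (\<Sum>H\<in>UNIV. breakdown N H / repair N H)"
    by (rule member_le_sum) (simp_all add: breakdown_nonneg repair_nonneg)
  then show ?thesis by (simp add: pi_hat_def breakdown_empty repair_empty)
qed

lemma pi_hat_pos_imp: "0 < pi_hat N D \<Longrightarrow> 0 < breakdown N D"
  using breakdown_nonneg[of D] by (auto simp: pi_hat_def less_le)

lemma qY_nonneg: "0 \<le> qY N D I"
  by (simp add: qY_def breakdown_nonneg repair_nonneg)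

lemma pi_hat_balance: "pi_hat N D * qY N D I = pi_hat N I * qY N I D"
proof -
  have less: "pi_hat N D * qY N D I = pi_hat N I * qY N I D" if "D \<subset> I" for D I
  proof (cases "breakdown N D = 0 \<or> repair N I = 0")
    case True
    then have "breakdown N I = 0" using breakdown_0[OF that] repair_0 by blast
    then show ?thesis using that by (auto simp: pi_hat_def qY_def)
  next
    case False
    then show ?thesis using that by (simp add: pi_hat_def qY_def)
  qed
  show ?thesis
    using less[of D I] less[of I D] by (cases "D \<subset> I \<or> I \<subset> D") (auto simp: qY_def)
qed

lemma pi_tilde_nonneg: "0 \<le> pi_tilde N x"
  by (cases x) (simp add: pi_tilde_def pi_hat_nonneg less_imp_le[OF pi_network_pos])

text \<open>
  For the summands of the generator that remove a job at node \<open>i\<close> from \<open>n\<close>, the substitution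
  \<open>n = add_job i m\<close> turns the weight \<open>pi_network N n * job_rate N i n\<close> into
  \<open>pi_network N m * \<eta> i\<close>; the states with an empty node \<open>i\<close> have rate \<open>0\<close>.
\<close>

lemma sum_add_job:
  assumes "finite G" "\<And>n. n \<notin> G \<Longrightarrow> F n = 0"
  shows "(\<Sum>n\<in>G. pi_network N n * job_rate N i n * F n)
    = (\<Sum>m\<in>(\<lambda>(i, n). remove_job i n) ` (UNIV \<times> G). pi_network N m * \<eta> i * F (add_job i m))"
    (is "_ = sum _ ?G'")
proof -
  have fin: "finite ?G'" using assms(1) by simp
  have inj: "inj_on (add_job i) ?G'" by (metis inj_onI remove_add_job)
  have zero: "job_rate N i n = 0" if "n \<in> G" "n \<notin> add_job i ` ?G'" for n
  proof (rule ccontr)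
    assume rate: "job_rate N i n \<noteq> 0"
    have "n = add_job i (remove_job i n)"
    proof (cases i)
      case (Some j)
      then have "n j \<noteq> 0" using rate service_0[of j] by (intro notI) (simp add: Some job_rate_def)
      then show ?thesis by (simp add: Some add_job_def remove_job_def plus_unit_def minus_unit_def)
    qed (simp add: add_job_def remove_job_def)
    then have "n \<in> add_job i ` ?G'" using that(1)
      by (metis (no_types, lifting) UNIV_I case_prod_conv image_eqI mem_Sigma_iff)
    then show False using that(2) by blast
  qed
  have "(\<Sum>m\<in>?G'. pi_network N m * \<eta> i * F (add_job i m))
      = (\<Sum>n\<in>add_job i ` ?G'. pi_network N n * job_rate N i n * F n)"
    by (simp add: sum.reindex[OF inj] pi_network_add_job)
  also have "\<dots> = (\<Sum>n\<in>G. pi_network N n * job_rate N i n * F n)"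
    using fin assms by (intro sum.mono_neutral_cong) (auto simp: zero)
  finally show ?thesis by simp
qed

text \<open>
  With \<open>m\<close> the configuration of the jobs that stay where they are and one further job at node
  \<open>i\<close>, the routing part of the generator acts on the position \<open>i\<close> like the finite matrix
  \<open>rerouting N D\<close>, with invariant measure \<open>\<eta>\<close>. Its quadratic form is an average over
  \<open>m\<close> of forms of that matrix minus the identity.
\<close>

definition route_form :: "'j set \<Rightarrow> ('j option \<Rightarrow> real) \<Rightarrow> ('j option \<Rightarrow> real) \<Rightarrow> real" where
  "route_form D u v = (\<Sum>i\<in>up_nodes D. \<Sum>j\<in>up_nodes D. \<eta> i * rerouting N D i j * (u i * (v j - v i)))"

lemma sum_gen_routing:
  assumes "finite G" "\<And>n. n \<notin> G \<Longrightarrow> f n = 0"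
  shows "(\<Sum>n\<in>G. pi_network N n * (f n * gen_routing N D g n))
    = (\<Sum>m\<in>(\<lambda>(i, n). remove_job i n) ` (UNIV \<times> G).
        pi_network N m * route_form D (\<lambda>i. f (add_job i m)) (\<lambda>i. g (add_job i m)))"
    (is "_ = sum _ ?G'")
proof -
  let ?F = "\<lambda>i j n. rerouting N D i j * (f n * (g (add_job j (remove_job i n)) - g n))"
  have "(\<Sum>n\<in>G. pi_network N n * (f n * gen_routing N D g n))
      = (\<Sum>n\<in>G. \<Sum>i\<in>up_nodes D. \<Sum>j\<in>up_nodes D. pi_network N n * job_rate N i n * ?F i j n)"
    by (simp add: gen_routing_def sum_distrib_left mult_ac)
  also have "\<dots> = (\<Sum>i\<in>up_nodes D. \<Sum>j\<in>up_nodes D. \<Sum>n\<in>G. pi_network N n * job_rate N i n * ?F i j n)"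
    by (subst sum.swap) (intro sum.cong refl sum.swap)
  also have "\<dots> = (\<Sum>i\<in>up_nodes D. \<Sum>j\<in>up_nodes D. \<Sum>m\<in>?G'. pi_network N m * \<eta> i * ?F i j (add_job i m))"
    by (intro sum.cong refl sum_add_job) (simp_all add: assms)
  also have "\<dots> = (\<Sum>m\<in>?G'. \<Sum>i\<in>up_nodes D. \<Sum>j\<in>up_nodes D. pi_network N m * \<eta> i * ?F i j (add_job i m))"
    by (simp only: sum.swap[of _ ?G'])
  also have "\<dots> = (\<Sum>m\<in>?G'. pi_network N m * route_form D (\<lambda>i. f (add_job i m)) (\<lambda>i. g (add_job i m)))"
    by (simp add: route_form_def sum_distrib_left mult_ac)
  finally show ?thesis .
qed

text \<open>
  The form of the generator splits into forms of the rerouting matrices and of the breakdown-repair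
  generator. Both symmetry in \<open>f\<close> and \<open>g\<close> and monotonicity in the network can be read off term by term.
\<close>

lemma inner_genZ:
  assumes "finite G" "{x. f x \<noteq> 0} \<subseteq> UNIV \<times> G"
  shows "inner_wrt UNIV (pi_tilde N) f (genZ N g)
    = (\<Sum>D\<in>UNIV. pi_hat N D * (\<Sum>m\<in>(\<lambda>(i, n). remove_job i n) ` (UNIV \<times> G).
          pi_network N m * route_form D (\<lambda>i. f (D, add_job i m)) (\<lambda>i. g (D, add_job i m))))
      + (\<Sum>n\<in>G. pi_network N n * inner_wrt UNIV (pi_hat N) (\<lambda>D. f (D, n)) (genY N (\<lambda>D. g (D, n))))"
proof -
  have G: "finite G" "f (D, n) = 0" if "n \<notin> G" for D n
    using assms that by auto
  let ?F = "\<lambda>x. f x * genZ N g x * pi_tilde N x"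
  have "inner_wrt UNIV (pi_tilde N) f (genZ N g) = (\<Sum>\<^sub>\<infinity>x\<in>UNIV \<times> G. ?F x)"
    unfolding inner_wrt_def by (rule infsum_cong_neutral) (auto, use G(2) in blast)
  also have "\<dots> = (\<Sum>D\<in>UNIV. \<Sum>n\<in>G. ?F (D, n))"
    using assms(1) by (simp add: sum.cartesian_product)
  also have "\<dots> = (\<Sum>D\<in>UNIV. \<Sum>n\<in>G. pi_hat N D * (pi_network N n * (f (D, n) * gen_routing N D (\<lambda>m. g (D, m)) n)))
      + (\<Sum>D\<in>UNIV. \<Sum>n\<in>G. pi_network N n * (f (D, n) * genY N (\<lambda>I. g (I, n)) D * pi_hat N D))"
    by (simp add: genZ_eq pi_tilde_def algebra_simps sum.distrib)
  also have "(\<Sum>D\<in>UNIV. \<Sum>n\<in>G. pi_hat N D * (pi_network N n * (f (D, n) * gen_routing N D (\<lambda>m. g (D, m)) n)))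
      = (\<Sum>D\<in>UNIV. pi_hat N D * (\<Sum>m\<in>(\<lambda>(i, n). remove_job i n) ` (UNIV \<times> G).
          pi_network N m * route_form D (\<lambda>i. f (D, add_job i m)) (\<lambda>i. g (D, add_job i m))))"
    unfolding sum_distrib_left[symmetric]
    by (intro sum.cong refl arg_cong2[where f = "(*)"] sum_gen_routing assms(1) G(2))
  also have "(\<Sum>D\<in>UNIV. \<Sum>n\<in>G. pi_network N n * (f (D, n) * genY N (\<lambda>I. g (I, n)) D * pi_hat N D))
      = (\<Sum>n\<in>G. pi_network N n * inner_wrt UNIV (pi_hat N) (\<lambda>D. f (D, n)) (genY N (\<lambda>D. g (D, n))))"
    by (subst sum.swap) (simp add: inner_wrt_def sum_distrib_left)
  finally show ?thesis .
qed

lemma inner_genY_commute: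
  "inner_wrt UNIV (pi_hat N) h (genY N k) = inner_wrt UNIV (pi_hat N) k (genY N h)"
proof -
  have "inner_wrt UNIV (pi_hat N) h (genY N k)
      = (\<Sum>D\<in>UNIV. \<Sum>I\<in>UNIV. pi_hat N D * qY N D I * (h D * (k I - k D)))" for h k
    by (simp add: inner_wrt_def genY_eq sum_distrib_left sum_distrib_right mult_ac)
  then show ?thesis
    using conductance_form_commute[of UNIV "\<lambda>D I. pi_hat N D * qY N D I" h k] pi_hat_balance by simp
qed

lemma xi_total_pos: "0 < (\<Sum>k\<in>up_nodes D. \<eta> k)"
  by (rule sum_pos) (auto simp: throughput0_pos up_nodes_eq)

end

locale reversible_jackson = jackson N for N :: "('j::finite) network" +
  assumes reversible: "reversible_matrix (up_nodes D) (xi N D) (rerouting N D)"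
begin

lemma route_form_commute: "route_form D u v = route_form D v u"
  unfolding route_form_def
proof (rule conductance_form_commute)
  fix i j assume "i \<in> up_nodes D" "j \<in> up_nodes D"
  then have "xi N D i * rerouting N D i j = xi N D j * rerouting N D j i"
    using reversible[of D] by (simp add: reversible_matrix_def)
  then show "\<eta> i * rerouting N D i j = \<eta> j * rerouting N D j i"
    using xi_total_pos[of D] by (simp add: xi_def field_simps)
qed

lemma inner_genZ_commute:
  assumes "finite {x. f x \<noteq> 0}" "finite {x. g x \<noteq> 0}"
  shows "inner_wrt UNIV (pi_tilde N) f (genZ N g) = inner_wrt UNIV (pi_tilde N) g (genZ N f)"
proof -
  let ?G = "snd ` ({x. f x \<noteq> 0} \<union> {x. g x \<noteq> 0})"
  have G: "finite ?G" using assms by simp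
  have f: "{x. f x \<noteq> 0} \<subseteq> UNIV \<times> ?G" and g: "{x. g x \<noteq> 0} \<subseteq> UNIV \<times> ?G"
    by (auto simp: image_Un intro: rev_image_eqI)
  have "(\<Sum>m\<in>M. pi_network N m * route_form D (\<lambda>i. f (D, add_job i m)) (\<lambda>i. g (D, add_job i m)))
      = (\<Sum>m\<in>M. pi_network N m * route_form D (\<lambda>i. g (D, add_job i m)) (\<lambda>i. f (D, add_job i m)))"
    for D M
    by (simp only: route_form_commute[of D "\<lambda>i. f (D, add_job i _)"])
  moreover have "inner_wrt UNIV (pi_hat N) (\<lambda>D. f (D, n)) (genY N (\<lambda>D. g (D, n)))
      = inner_wrt UNIV (pi_hat N) (\<lambda>D. g (D, n)) (genY N (\<lambda>D. f (D, n)))" for n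
    by (rule inner_genY_commute)
  ultimately show ?thesis
    using inner_genZ[of ?G f g, OF G f] inner_genZ[of ?G g f, OF G g] by simp
qed

lemma genZ_detailed_balance:
  "pi_tilde N x * genZ N (indicator {y}) x = pi_tilde N y * genZ N (indicator {x}) y"
proof -
  have "inner_wrt UNIV (pi_tilde N) (indicator {x}) h = pi_tilde N x * h x" for x h
  proof -
    have "inner_wrt UNIV (pi_tilde N) (indicator {x}) h
        = (\<Sum>\<^sub>\<infinity>z\<in>{x}. indicator {x} z * h z * pi_tilde N z)"
      unfolding inner_wrt_def by (rule infsum_cong_neutral) (auto simp: indicator_def)
    then show ?thesis by simp
  qed
  then show ?thesis
    using inner_genZ_commute[of "indicator {x}" "indicator {y}"] by (simp add: indicator_eq_0_iff)
qed

end

section \<open>Connectedness and aperiodicity\<close>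

context jackson
begin

text \<open>
  At a zero of a nonnegative function all summands of the generator are nonnegative, so each of them
  is a lower bound. For indicators this bounds transition rates from below.
\<close>

lemma
  assumes "\<And>x. 0 \<le> h x" "h (D, n) = 0"
  shows genZ_ge_routing: "i \<in> up_nodes D \<Longrightarrow> j \<in> up_nodes D \<Longrightarrow>
      job_rate N i n * rerouting N D i j * h (D, add_job j (remove_job i n)) \<le> genZ N h (D, n)"
    and genZ_ge_environment: "qY N D I * h (I, n) \<le> genZ N h (D, n)"
proof -
  have nn: "0 \<le> job_rate N i n * rerouting N D i j * h x" if "i \<in> up_nodes D" "j \<in> up_nodes D" for i j x
    by (intro mult_nonneg_nonneg job_rate_nonneg rerouting_nonneg assms(1) that)
  have Y: "0 \<le> qY N D I * h (I, n)" for I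
    by (intro mult_nonneg_nonneg qY_nonneg assms(1))
  have eq: "genZ N h (D, n) = (\<Sum>i\<in>up_nodes D. \<Sum>j\<in>up_nodes D.
      job_rate N i n * rerouting N D i j * h (D, add_job j (remove_job i n)))
      + (\<Sum>I\<in>UNIV. qY N D I * h (I, n))"
    by (simp add: genZ_eq gen_routing_def genY_eq assms(2))
  have R_nonneg: "0 \<le> (\<Sum>i\<in>up_nodes D. \<Sum>j\<in>up_nodes D.
      job_rate N i n * rerouting N D i j * h (D, add_job j (remove_job i n)))"
    by (intro sum_nonneg nn)
  have Y_nonneg: "0 \<le> (\<Sum>I\<in>UNIV. qY N D I * h (I, n))"
    by (intro sum_nonneg Y)
  show "job_rate N i n * rerouting N D i j * h (D, add_job j (remove_job i n)) \<le> genZ N h (D, n)"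
    if ij: "i \<in> up_nodes D" "j \<in> up_nodes D"
  proof -
    have "job_rate N i n * rerouting N D i j * h (D, add_job j (remove_job i n))
        \<le> (\<Sum>j\<in>up_nodes D. job_rate N i n * rerouting N D i j * h (D, add_job j (remove_job i n)))"
      using ij(2) by (rule member_le_sum) (simp_all add: nn ij)
    also have "\<dots> \<le> (\<Sum>i\<in>up_nodes D. \<Sum>j\<in>up_nodes D.
        job_rate N i n * rerouting N D i j * h (D, add_job j (remove_job i n)))"
      using ij(1) by (rule member_le_sum) (auto intro!: sum_nonneg nn)
    finally show ?thesis using eq Y_nonneg by linarith
  qed
  have "qY N D I * h (I, n) \<le> (\<Sum>I\<in>UNIV. qY N D I * h (I, n))"
    by (rule member_le_sum) (simp_all add: Y)
  then show "qY N D I * h (I, n) \<le> genZ N h (D, n)" using eq R_nonneg by linarith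
qed

text \<open>
  At a station \<open>k\<close> with one job there is an additional possible event, the departure of that job
  from \<open>k\<close>; the probability \<open>routing N (Some k) (Some k)\<close> of an immediate return is less than \<open>1\<close>.
\<close>

lemma exit_rate_less:
  "genZ N (indicator {({}, add_job (Some k) (\<lambda>_. 0))}) ({}, add_job (Some k) (\<lambda>_. 0))
    < genZ N (indicator {({}, \<lambda>_. 0)}) ({}, \<lambda>_. 0)"
proof -
  let ?o = "\<lambda>_::'j. 0::nat"
  let ?n = "add_job (Some k) ?o"
  let ?r = "routing N"
  let ?row = "\<lambda>n i. \<Sum>j\<in>UNIV. job_rate N i n * ?r i j
      * (indicator {({} :: 'j set, n)} ({} :: 'j set, add_job j (remove_job i n)) - 1)"
  have gen: "genZ N (indicator {({}, n)}) ({}, n)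
      = (\<Sum>i\<in>UNIV. ?row n i) + (\<Sum>I\<in>UNIV. qY N {} I * (indicator {{}} I - 1))" for n
    by (simp add: genZ_eq gen_routing_def genY_eq indicator_def)
  have None: "?row n None = - arrival N * (\<Sum>j\<in>-{None}. ?r None j)" for n
  proof -
    have "?row n None = (\<Sum>j\<in>UNIV. arrival N * ?r None j * ((if j = None then 1 else 0) - 1))"
      using add_job_eq_iff[of _ n None]
      by (intro sum.cong) (auto simp: job_rate_def remove_job_def indicator_def add_job_def)
    also have "\<dots> = (\<Sum>j\<in>-{None}. - arrival N * ?r None j)"
      by (intro sum.mono_neutral_cong_right) auto
    finally show ?thesis by (simp add: sum_distrib_left)
  qed
  have o: "?row ?o (Some l) = 0" for l
    by (simp add: job_rate_def service_0)
  have r: "0 \<le> ?r i j" for i j using rerouting_nonneg[of i "{}" j] by simp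
  have row_le: "?row n i \<le> 0" for n i
    by (intro sum_nonpos mult_nonneg_nonpos mult_nonneg_nonneg job_rate_nonneg r)
      (simp add: indicator_def)
  have "\<exists>j. j \<noteq> Some k \<and> 0 < ?r (Some k) j"
  proof (rule ccontr)
    assume "\<not> ?thesis"
    then have "None = Some k"
      using trancl_invariant[OF irreducible[of "Some k" None], of "\<lambda>i. i = Some k"] by auto
    then show False by simp
  qed
  then obtain j where j: "j \<noteq> Some k" "0 < ?r (Some k) j" by blast
  have "?row ?n (Some k) \<le> job_rate N (Some k) ?n * ?r (Some k) j
      * (indicator {({} :: 'j set, ?n)} ({} :: 'j set, add_job j (remove_job (Some k) ?n)) - 1)"
  proof -
    have "(\<Sum>l\<in>UNIV - {j}. job_rate N (Some k) ?n * ?r (Some k) l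
      * (indicator {({} :: 'j set, ?n)} ({} :: 'j set, add_job l (remove_job (Some k) ?n)) - 1)) \<le> 0"
      by (intro sum_nonpos mult_nonneg_nonpos mult_nonneg_nonneg job_rate_nonneg r)
        (simp add: indicator_def)
    then show ?thesis by (subst sum.remove[of UNIV j]) simp_all
  qed
  also have "\<dots> = - (job_rate N (Some k) ?n * ?r (Some k) j)"
    using j(1) by (simp add: indicator_def)
  also have "\<dots> < 0" using job_rate_add_job_pos[of "Some k" ?o] j(2) by simp
  finally have row_less: "?row ?n (Some k) < 0" .
  have "(\<Sum>i\<in>UNIV. ?row ?n i) < (\<Sum>i\<in>UNIV. ?row ?o i)"
  proof (rule sum_strict_mono_ex1)
    show "\<forall>i\<in>UNIV. ?row ?n i \<le> ?row ?o i"
    proof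
      fix i
      show "?row ?n i \<le> ?row ?o i"
        by (cases i) (simp only: None, simp only: o row_le)
    qed
    show "\<exists>i\<in>UNIV. ?row ?n i < ?row ?o i"
      using row_less by (intro bexI[of _ "Some k"]) (simp_all only: o UNIV_I)
  qed simp
  then show ?thesis by (simp only: gen)
qed

end

context reversible_jackson
begin

text \<open>
  Jobs are moved one step of a path in the routing graph at a time, which connects \<open>n\<close> with
  \<open>add_job i n\<close>, and nodes break down from the fully functioning state. The state without jobs
  has a smaller exit rate than some other state, whose holding probability is nonnegative, so its
  own holding probability is positive.
\<close>

lemma aperiodic_reversible_kernel:
  assumes "0 < \<epsilon>" and stoch: "stochastic_operator (id_plus \<epsilon> (genZ N))"
  shows "aperiodic_reversible_kernel (pi_tilde N) (id_plus \<epsilon> (genZ N)) ({}, \<lambda>_. 0)"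
proof -
  interpret K: reversible_kernel "pi_tilde N" "id_plus \<epsilon> (genZ N)"
  proof
    fix x y
    show "0 \<le> pi_tilde N x" by (rule pi_tilde_nonneg)
    show "stochastic_operator (id_plus \<epsilon> (genZ N))" by (rule stoch)
    show "finitary (\<lambda>f. id_plus \<epsilon> (genZ N) f x)"
      unfolding id_plus_def by (intro finitary_add finitary_apply finitary_cmult finitary_genZ)
    show "pi_tilde N x * id_plus \<epsilon> (genZ N) (indicator {y}) x
        = pi_tilde N y * id_plus \<epsilon> (genZ N) (indicator {x}) y"
      using genZ_detailed_balance[of x y]
      by (auto simp: id_plus_def indicator_def algebra_simps)
  qed
  let ?E = "{(y, z). 0 < K.flow y z}"
  have edge: "(x, y) \<in> ?E" if "x \<noteq> y" "0 < pi_tilde N x" "0 < genZ N (indicator {y}) x" for x y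
    using that \<open>0 < \<epsilon>\<close> by (simp add: K.flow_def K.p_def id_plus_def)
  have pos: "0 < pi_tilde N ({}, n)" for n
    by (simp add: pi_tilde_def pi_hat_empty_pos pi_network_pos)
  have move: "(({}, add_job i m), ({}, add_job j m)) \<in> ?E\<^sup>*" if "0 < routing N i j" for i j m
  proof (cases "i = j")
    case False
    have "0 < job_rate N i (add_job i m) * routing N i j"
      using job_rate_add_job_pos that by simp
    also have "\<dots> \<le> genZ N (indicator {({}, add_job j m)}) ({}, add_job i m)"
      using genZ_ge_routing[of "indicator {({}, add_job j m)}" "{}" "add_job i m" i j] False
      by (simp add: indicator_def)
    finally have "(({}, add_job i m), ({}, add_job j m)) \<in> ?E"
      using False by (intro edge pos) auto
    then show ?thesis by blast
  qed simp
  have path: "(({}, add_job i m), ({}, add_job j m)) \<in> ?E\<^sup>*" for i j m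
    using irreducible[of i j]
  proof (induction rule: trancl_induct)
    case (base j)
    then show ?case using move by blast
  next
    case (step j k)
    then show ?case using move[of j k m] by (auto intro: rtrancl_trans)
  qed
  have jobs: "(({}, \<lambda>_. 0), ({}, n)) \<in> ?E\<^sup>*" for n :: "'j \<Rightarrow> nat"
  proof (induction "sum n UNIV" arbitrary: n)
    case 0
    then have "n = (\<lambda>_. 0)" by auto
    then show ?case by simp
  next
    case (Suc s)
    then obtain k where k: "n k \<noteq> 0" by (metis nat.distinct(1) sum.neutral)
    let ?m = "minus_unit n k"
    have n: "n = add_job (Some k) ?m"
      using k by (auto simp: add_job_def plus_unit_def minus_unit_def)
    have "sum n UNIV = n k + sum n (UNIV - {k})" "sum ?m UNIV = ?m k + sum ?m (UNIV - {k})"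
      by (simp_all add: sum.remove)
    moreover have "sum ?m (UNIV - {k}) = sum n (UNIV - {k})"
      by (rule sum.cong) (auto simp: minus_unit_def)
    ultimately have "s = sum ?m UNIV"
      using Suc(2) k by (simp add: minus_unit_def)
    then have "(({}, \<lambda>_. 0), ({}, ?m)) \<in> ?E\<^sup>*" by (rule Suc(1))
    moreover have "(({}, ?m), ({}, n)) \<in> ?E\<^sup>*"
      using path[of None ?m "Some k"] n by (simp add: add_job_def)
    ultimately show ?case by (rule rtrancl_trans)
  qed
  show ?thesis
  proof
    show "0 < K.flow ({}, \<lambda>_. 0) ({}, \<lambda>_. 0)"
    proof -
      fix k :: 'j
      let ?x = "({} :: 'j set, add_job (Some k) (\<lambda>_. 0))"
      have "0 \<le> 1 + \<epsilon> * genZ N (indicator {?x}) ?x"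
        using K.p_nonneg[of ?x ?x] by (simp add: K.p_def id_plus_def)
      also have "\<dots> < 1 + \<epsilon> * genZ N (indicator {({}, \<lambda>_. 0)}) ({}, \<lambda>_. 0)"
        using exit_rate_less[of k] \<open>0 < \<epsilon>\<close> by simp
      finally show ?thesis
        using pos by (simp add: K.flow_def K.p_def id_plus_def)
    qed
  next
    fix x assume "0 < pi_tilde N x"
    obtain D n where x: "x = (D, n)" by (cases x)
    have D: "0 < pi_hat N D"
      using \<open>0 < pi_tilde N x\<close> pi_network_pos[of n] by (simp add: x pi_tilde_def zero_less_mult_iff)
    show "(({}, \<lambda>_. 0), x) \<in> ?E\<^sup>*"
    proof (cases "D = {}")
      case False
      then have "0 < qY N {} D"
        using pi_hat_pos_imp[OF D] by (auto simp: qY_def breakdown_empty)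
      also have "\<dots> \<le> genZ N (indicator {x}) ({}, n)"
        using genZ_ge_environment[of "indicator {x}" "{}" n D] False
        by (simp add: x indicator_def)
      finally have "(({}, n), x) \<in> ?E"
        using False pos by (intro edge) (auto simp: x)
      then show ?thesis using jobs[of n] by (rule rtrancl_into_rtrancl[rotated])
    qed (simp add: x jobs)
  qed
qed

end

section \<open>Comparison of two networks\<close>

text \<open>
  The throughputs, and with them \<open>\<xi>\<close>, are determined by the service rates and the stationary
  distribution. So two networks with the same service rates and stationary distribution have the
  same invariant measure for their routing matrices.
\<close>

lemma (in jackson) throughput_from_pi_tilde:
  "throughput N k * pi_tilde N ({}, \<lambda>_. 0) = service N k 1 * pi_tilde N ({}, add_job (Some k) (\<lambda>_. 0))"
  using pi_network_add_job[of "Some k" "\<lambda>_. 0"]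
  by (simp add: pi_tilde_def job_rate_def throughput0_def) (simp add: add_job_def plus_unit_def mult_ac)

lemma throughput_eqI:
  assumes "unreliable_jackson_network N" "unreliable_jackson_network N'"
    and "service N' = service N" "pi_tilde N' = pi_tilde N"
  shows "throughput N' k = throughput N k"
proof -
  interpret N: jackson N by unfold_locales (rule assms)
  interpret N': jackson N' by unfold_locales (rule assms)
  have "0 < pi_tilde N ({}, \<lambda>_. 0)"
    by (simp add: pi_tilde_def N.pi_hat_empty_pos N.pi_network_pos)
  moreover have "throughput N' k * pi_tilde N ({}, \<lambda>_. 0) = throughput N k * pi_tilde N ({}, \<lambda>_. 0)"
    using N.throughput_from_pi_tilde[of k] N'.throughput_from_pi_tilde[of k] assms(3,4) by simp
  ultimately show ?thesis by simp
qed

text \<open>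
  The two forms differ by that of \<open>rerouting N D - rerouting N' D\<close> alone: the diagonal
  terms \<open>\<eta> i * (u i)\<^sup>2\<close> cancel because all rows have sum \<open>1\<close>. The normalization of \<open>\<xi>\<close> is a positive
  factor.
\<close>

lemma route_form_mono:
  assumes N: "unreliable_jackson_network N" and N': "unreliable_jackson_network N'"
    and throughput: "throughput0 N' = throughput0 N"
    and order: "pd_le (up_nodes D) (xi N D) (rerouting N' D) (rerouting N D)"
  shows "jackson.route_form N' D u u \<le> jackson.route_form N D u u"
proof -
  interpret N: jackson N by unfold_locales (rule N)
  interpret N': jackson N' by unfold_locales (rule N')
  let ?U = "up_nodes D" let ?t = "\<Sum>k\<in>?U. N.\<eta> k"
  have form: "jackson.route_form M D u u = (\<Sum>i\<in>?U. N.\<eta> i * (u i * (\<Sum>j\<in>?U. rerouting M D i j * u j)))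
      - (\<Sum>i\<in>?U. N.\<eta> i * (u i)\<^sup>2)"
    if "jackson M" "throughput0 M = N.\<eta>" for M
  proof -
    have row: "(\<Sum>j\<in>?U. rerouting M D i j) = 1" if "i \<in> ?U" for i
      by (rule jackson.rerouting_row[OF \<open>jackson M\<close> that])
    have "(\<Sum>j\<in>?U. N.\<eta> i * rerouting M D i j * (u i * (u j - u i)))
        = N.\<eta> i * (u i * (\<Sum>j\<in>?U. rerouting M D i j * u j)) - N.\<eta> i * (u i)\<^sup>2" if "i \<in> ?U" for i
    proof -
      have "(\<Sum>j\<in>?U. N.\<eta> i * rerouting M D i j * (u i * (u j - u i)))
          = N.\<eta> i * (u i * (\<Sum>j\<in>?U. rerouting M D i j * u j))
            - N.\<eta> i * (u i)\<^sup>2 * (\<Sum>j\<in>?U. rerouting M D i j)"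
        by (simp add: sum_distrib_left sum_subtractf algebra_simps power2_eq_square)
      then show ?thesis by (simp add: row that)
    qed
    then show ?thesis
      by (simp add: jackson.route_form_def[OF \<open>jackson M\<close>] that sum_subtractf)
  qed
  have "0 \<le> inner_wrt ?U (xi N D) u (\<lambda>i. \<Sum>j\<in>?U. (rerouting N D i j - rerouting N' D i j) * u j)"
    using order by (simp add: pd_le_def)
  also have "\<dots> = (\<Sum>i\<in>?U. N.\<eta> i * (u i * (\<Sum>j\<in>?U. (rerouting N D i j - rerouting N' D i j) * u j))) / ?t"
    by (simp add: inner_wrt_def xi_def sum_divide_distrib mult_ac)
  finally have "0 \<le> (\<Sum>i\<in>?U. N.\<eta> i * (u i * (\<Sum>j\<in>?U. (rerouting N D i j - rerouting N' D i j) * u j)))"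
    using N.xi_total_pos[of D] by (simp add: zero_le_divide_iff)
  also have "\<dots> = jackson.route_form N D u u - jackson.route_form N' D u u"
    unfolding form[OF N.jackson_axioms refl] form[OF N'.jackson_axioms throughput]
    by (simp add: left_diff_distrib right_diff_distrib sum_subtractf)
  finally show ?thesis by simp
qed

lemma inner_id_plus:
  assumes "finite {x. h x \<noteq> 0}"
  shows "inner_wrt UNIV \<nu> h (id_plus \<epsilon> Q h) = inner_wrt UNIV \<nu> h h + \<epsilon> * inner_wrt UNIV \<nu> h (Q h)"
proof -
  have "(\<lambda>x. h x * g x * \<nu> x) summable_on UNIV" for g
    by (rule finite_nonzero_values_imp_summable_on) (rule finite_subset[OF _ assms], auto)
  note s = this[of h] this[of "\<lambda>x. \<epsilon> * Q h x"]
  have "inner_wrt UNIV \<nu> h (id_plus \<epsilon> Q h) = inner_wrt UNIV \<nu> h h + inner_wrt UNIV \<nu> h (\<lambda>x. \<epsilon> * Q h x)"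
    using infsum_add[OF s] by (simp add: inner_wrt_def id_plus_def distrib_left distrib_right)
  then show ?thesis by (simp only: inner_wrt_cmult_right)
qed

theorem proposition4p10:
  fixes N N' :: "('j::finite) network"
    and \<epsilon> :: real
    and f :: "'j state \<Rightarrow> real"
  assumes "unreliable_jackson_network N"
    and "unreliable_jackson_network N'"
    and "arrival N' = arrival N"
    and "service N' = service N"
    and "ergodic (genZ N)"
    and "ergodic (genZ N')"
    and "pi_tilde N' = pi_tilde N"
    and "breakdown_pd_le N' N"
    and "reversible_matrix UNIV (xi N {}) (routing N)"
    and "reversible_matrix UNIV (xi N {}) (routing N')"
    and "\<And>D. reversible_matrix (up_nodes D) (xi N D) (rerouting N D)"
    and "\<And>D. reversible_matrix (up_nodes D) (xi N D) (rerouting N' D)"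
    and "\<And>D. pd_le (up_nodes D) (xi N D) (rerouting N' D) (rerouting N D)"
    and "0 < \<epsilon>"
    and "stochastic_operator (id_plus \<epsilon> (genZ N))"
    and "stochastic_operator (id_plus \<epsilon> (genZ N'))"
    and "f \<in> L2_0 (pi_tilde N)"
  shows "asymptotic_variance (pi_tilde N) f (id_plus \<epsilon> (genZ N)) \<ge>
         asymptotic_variance (pi_tilde N) f (id_plus \<epsilon> (genZ N'))"
proof -
  have throughput: "throughput0 N' = throughput0 N"
    using throughput_eqI[OF assms(1,2,4,7)] assms(3)
    by (auto simp: throughput0_def fun_eq_iff split: option.split)
  then have xi: "xi N' = xi N" by (simp add: xi_def fun_eq_iff)
  interpret N: reversible_jackson N
    by unfold_locales (rule assms)+
  interpret N': reversible_jackson N'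
    by unfold_locales (simp_all only: xi assms)
  have "throughput N' = throughput N"
    using throughput_eqI[OF assms(1,2,4,7)] by blast
  then have pi_network: "pi_network N' n = pi_network N n" for n
    by (simp add: pi_network_def assms(4))
  have pi_hat: "pi_hat N' D = pi_hat N D" for D
    using fun_cong[OF assms(7), of "(D, \<lambda>_. 0)"] N.pi_network_pos[of "\<lambda>_. 0"]
    by (simp add: pi_tilde_def pi_network)
  have environment: "inner_wrt UNIV (pi_hat N) h (genY N' h) \<le> inner_wrt UNIV (pi_hat N) h (genY N h)" for h
  proof -
    have "0 \<le> inner_wrt UNIV (pi_hat N) h (\<lambda>D. genY N h D - genY N' h D)"
      using assms(8) by (simp add: breakdown_pd_le_def)
    then show ?thesis
      by (simp add: inner_wrt_def left_diff_distrib right_diff_distrib sum_subtractf)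
  qed
  have generators: "inner_wrt UNIV (pi_tilde N) h (genZ N' h) \<le> inner_wrt UNIV (pi_tilde N) h (genZ N h)"
    if "finite {x. h x \<noteq> 0}" for h
  proof -
    let ?G = "snd ` {x. h x \<noteq> 0}"
    have G: "finite ?G" using that by simp
    have h: "{x. h x \<noteq> 0} \<subseteq> UNIV \<times> ?G" by (auto intro: rev_image_eqI)
    have form': "inner_wrt UNIV (pi_tilde N) h (genZ N' h)
      = (\<Sum>D\<in>UNIV. pi_hat N D * (\<Sum>m\<in>(\<lambda>(i, n). remove_job i n) ` (UNIV \<times> ?G).
          pi_network N m * N'.route_form D (\<lambda>i. h (D, add_job i m)) (\<lambda>i. h (D, add_job i m))))
      + (\<Sum>n\<in>?G. pi_network N n * inner_wrt UNIV (pi_hat N) (\<lambda>D. h (D, n)) (genY N' (\<lambda>D. h (D, n))))"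
      using N'.inner_genZ[of ?G h h, OF G h]
      by (simp only: assms(7) pi_network ext[of "pi_hat N'" "pi_hat N", OF pi_hat])
    show ?thesis
      unfolding form' N.inner_genZ[of ?G h h, OF G h]
      by (intro add_mono sum_mono mult_left_mono environment N.pi_hat_nonneg
          less_imp_le[OF N.pi_network_pos] route_form_mono[OF assms(1,2) throughput assms(13)])
  qed
  have order: "inner_wrt UNIV (pi_tilde N) h (id_plus \<epsilon> (genZ N') h)
      \<le> inner_wrt UNIV (pi_tilde N) h (id_plus \<epsilon> (genZ N) h)" if "finite {x. h x \<noteq> 0}" for h
    using mult_left_mono[OF generators[OF that] less_imp_le[OF assms(14)]]
    by (simp add: inner_id_plus[OF that])
  have "f \<in> L2 (pi_tilde N)" using assms(17) by (simp add: L2_0_def)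
  then show ?thesis
    by (intro asymptotic_variance_antimono[OF N.aperiodic_reversible_kernel[OF assms(14,15)]
          N'.aperiodic_reversible_kernel[OF assms(14,16), unfolded assms(7)]] order)
qed

end
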